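(* Let $V>0$ be finite with $\sup_{t\in\mathcal{T}}\|A_t\|_2\le V$. For any $\delta\in[0,1]$, if $\beta\ge4\sigma^2V(1+4\delta)$ and $\beta>4\sigma^2V$, let \[\gamma=\frac{\beta-4\sigma^2V(1+2\delta)-\sqrt{\beta-4\sigma^2V}\sqrt{\beta-4\sigma^2V(1+4\delta)}}{16\sigma^2\delta V^2}\quad\text{if }\delta>0,\qquad\gamma=0\quad\text{if }\delta=0.\] If for every $t\in\mathcal{T}$ \[\mathrm{pen}(t)\ge\frac{4\sigma^2}{\beta-4\sigma^2V}\Big(\sigma^2\mathrm{Tr}(A_t^2)+2(1-\delta)(1+2\gamma V)^2\big[\widetilde{\|f_0-b\|}_\infty^2\mathrm{Tr}(A_t^2)+\|b_t\|_2^2\big]\Big),\] then: (i) for any $\eta\in(0,1]$, with probability at least $1-\eta$, \[\|f_0-f_{EWA}\|_2^2\le\inf_{\nu\in N}\inf_{\mu\in\mathcal{M}_+^1(\mathcal{T})}\Big\{(1+\epsilon(\nu))\int\|f_0-\hat f_t\|_2^2\,d\mu(t)+(1+\epsilon'(\nu))\int\mathrm{price}(t)\,d\mu(t)+\beta(1+\epsilon'(\nu))\Big(2\,\mathrm{KL}(\mu,\pi)+\ln\frac1\eta\Big)\Big\};\] (ii) furthermore, \[\mathbb{E}\|f_0-f_{EWA}\|_2^2\le\inf_{\nu\in N}\inf_{\mu\in\mathcal{M}_+^1(\mathcal{T})}\Big\{(1+\epsilon(\nu))\int\mathbb{E}\|f_0-\hat f_t\|_2^2\,d\mu(t)+(1+\epsilon'(\nu))\int\mathrm{price}(t)\,d\mu(t)+2\beta(1+\epsilon'(\nu))\mathrm{KL}(\mu,\pi)\Big\};\]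 where \[\epsilon(\nu)=\frac{1+\nu}{\nu}\,\frac{(1+\nu)\gamma}{1-(1+\nu)\gamma},\qquad\epsilon'(\nu)=\frac{(1+\nu)\gamma}{1-(1+\nu)\gamma},\] \[\mathrm{price}(t)=\mathrm{pen}(t)+2\sigma^2\mathrm{Tr}(A_t)+\frac{8\sigma^2(1-\delta)}{\beta-4\sigma^2V}(1+2\gamma V)^2\big[\widetilde{\|f_0-b\|}_\infty^2\mathrm{Tr}(A_t^2)+\|b_t\|_2^2\big],\] and $N=\{\nu>0\mid(1+\nu)\gamma<1\}$.
   Context: Model: one observes $Y=f_0+W\in\mathbb{R}^n$, i.e. $Y_i=f_0(x_i)+W_i$ at fixed design points $x_1,\dots,x_n$; the unknown function $f_0$ is identified with the deterministic vector $(f_0(x_i))_{i=1}^n\in\mathbb{R}^n$. The noise $W$ is a random vector in $\mathbb{R}^n$ (coordinates not assumed independent) with $\mathbb{E}(W)=0$ and, for a known $\sigma^2>0$, $\mathbb{E}[\exp(\alpha^\top W)]\le\exp(\frac{\sigma^2}{2}\|\alpha\|_2^2)$ for all $\alpha\in\mathbb{R}^n$. For vectors $\|\cdot\|_2$ is the Euclidean norm; for matrices $\|\cdot\|_2$ is the operator (spectral) norm. Estimators: $\mathcal{T}$ is a measurable space (not necessarily countable). For $t\in\mathcal{T}$, $A_t$ is a (deterministic) real symmetric positive semi-definite $n\times n$ matrix, $b_t\in\mathbb{R}^n$, and $b\in\mathbb{R}^n$ is a fixed common recentring vector; $\hat f_t=\hat f_t(Y)=A_t(Y-b)+b+b_t$.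 $\widetilde{\|f_0-b\|}_\infty$ denotes the smallest real $C\ge0$ such that $\|A_t(f_0-b)\|_2^2\le C^2\,\mathrm{Tr}(A_t^2)$ for all $t\in\mathcal{T}$. Aggregate: $\mathrm{pen}:\mathcal{T}\to\mathbb{R}$ is a deterministic penalty, $\pi$ a prior probability measure on $\mathcal{T}$, $\beta>0$ the temperature. The maps $t\mapsto A_t,b_t,\mathrm{pen}(t)$ are measurable. Set $r_t=\|Y-\hat f_t(Y)\|_2^2+2\sigma^2\mathrm{Tr}(A_t)-n\sigma^2$ and $\widetilde r_t=r_t+\mathrm{pen}(t)$. Define the probability measure $d\rho_{EWA}(t)=\frac{\exp(-\widetilde r_t/\beta)}{\int\exp(-\widetilde r_{t'}/\beta)\,d\pi(t')}\,d\pi(t)$ and the exponentially weighted aggregate $f_{EWA}=\int\hat f_t\,d\rho_{EWA}(t)$. $\mathcal{M}_+^1(\mathcal{T})$ is the set of probability measures on $\mathcal{T}$; $\mathrm{KL}(\mu,\pi)$ is the Kullback–Leibler divergence, $\int\ln\frac{d\mu}{d\pi}\,d\mu$ if $\mu\ll\pi$ and $+\infty$ otherwise. The infimum over an empty set is $+\infty$ (so the bounds are vacuous if $N=\emptyset$). *)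

theory Defs
  imports "HOL-Probability.Probability"
begin

definition sym_psd :: "real^'n^'n \<Rightarrow> bool" where
  "sym_psd A \<longleftrightarrow> transpose A = A \<and> (\<forall>x. 0 \<le> x \<bullet> (A *v x))"

definition spectral_norm :: "real^'n^'n \<Rightarrow> real" where
  "spectral_norm A = onorm (\<lambda>x. A *v x)"

(* The Laplace transform is a Lebesgue integral in [0, \<infinity>], so the bound below includes
   the finiteness of E exp(\<alpha> \<bullet> W). *)
definition subgaussian_noise :: "'w measure \<Rightarrow> real \<Rightarrow> ('w \<Rightarrow> real^'n) \<Rightarrow> bool" where
  "subgaussian_noise P \<sigma> W \<longleftrightarrow>
     has_bochner_integral P W 0 \<and>
     (\<forall>\<alpha>. (\<integral>\<^sup>+ \<omega>. ennreal (exp (\<alpha> \<bullet> W \<omega>)) \<partial>P) \<le> ennreal (exp (\<sigma>\<^sup>2 / 2 * (norm \<alpha>)\<^sup>2)))"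

(* An inner-probability reading: it agrees with "prob {\<omega>. Q \<omega>} \<ge> p" whenever {\<omega>. Q \<omega>} is
   an event, and does not ask for the measurability of Q (which may be an uncountable infimum). *)
definition with_prob_at_least :: "'w measure \<Rightarrow> real \<Rightarrow> ('w \<Rightarrow> bool) \<Rightarrow> bool" where
  "with_prob_at_least P p Q \<longleftrightarrow> (\<exists>E\<in>sets P. p \<le> measure P E \<and> (\<forall>\<omega>\<in>E. Q \<omega>))"

(* KL_divergence is a Bochner integral, hence 0 when it diverges. For \<mu> absolutely continuous
   w.r.t. \<pi> the negative part of ln (d\<mu>/d\<pi>) is always \<mu>-integrable, so non-integrability
   means that the integral is +\<infinity>. *)
definition KL :: "'t measure \<Rightarrow> 't measure \<Rightarrow> ennreal" where
  "KL \<mu> \<pi> =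
     (if absolutely_continuous \<pi> \<mu> \<and> integrable \<mu> (entropy_density (exp 1) \<pi> \<mu>)
      then ennreal (KL_divergence (exp 1) \<pi> \<mu>) else \<infinity>)"

definition fhat ::
  "('t \<Rightarrow> real^'n^'n) \<Rightarrow> ('t \<Rightarrow> real^'n) \<Rightarrow> real^'n \<Rightarrow> real^'n \<Rightarrow> 't \<Rightarrow> real^'n" where
  "fhat A bt b y t = A t *v (y - b) + b + bt t"

(* The smallest constant for a family of matrices indexed by the points of T, at the vector v;
   used with v = f0 - b. *)
definition tilde_norm :: "'t measure \<Rightarrow> ('t \<Rightarrow> real^'n^'n) \<Rightarrow> real^'n \<Rightarrow> real" where
  "tilde_norm T A v =
     (LEAST C. 0 \<le> C \<and> (\<forall>t\<in>space T. (norm (A t *v v))\<^sup>2 \<le> C\<^sup>2 * trace (A t ** A t)))"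

definition risk_est ::
  "real \<Rightarrow> ('t \<Rightarrow> real^'n^'n) \<Rightarrow> ('t \<Rightarrow> real^'n) \<Rightarrow> real^'n \<Rightarrow> real^'n \<Rightarrow> 't \<Rightarrow> real" where
  "risk_est \<sigma> A bt b y t =
     (norm (y - fhat A bt b y t))\<^sup>2 + 2 * \<sigma>\<^sup>2 * trace (A t) - real CARD('n) * \<sigma>\<^sup>2"

definition pen_risk_est ::
  "real \<Rightarrow> ('t \<Rightarrow> real^'n^'n) \<Rightarrow> ('t \<Rightarrow> real^'n) \<Rightarrow> real^'n \<Rightarrow> ('t \<Rightarrow> real) \<Rightarrow> real^'n \<Rightarrow> 't \<Rightarrow> real"
where
  "pen_risk_est \<sigma> A bt b pen y t = risk_est \<sigma> A bt b y t + pen t"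

definition gibbs :: "'t measure \<Rightarrow> real \<Rightarrow> ('t \<Rightarrow> real) \<Rightarrow> 't measure" where
  "gibbs \<pi> \<beta> r =
     density \<pi> (\<lambda>t. ennreal (exp (- r t / \<beta>) / (\<integral>s. exp (- r s / \<beta>) \<partial>\<pi>)))"

definition f_EWA ::
  "'t measure \<Rightarrow> real \<Rightarrow> real \<Rightarrow> ('t \<Rightarrow> real^'n^'n) \<Rightarrow> ('t \<Rightarrow> real^'n) \<Rightarrow> real^'n
     \<Rightarrow> ('t \<Rightarrow> real) \<Rightarrow> real^'n \<Rightarrow> real^'n" where
  "f_EWA \<pi> \<beta> \<sigma> A bt b pen y =
     (\<integral>t. fhat A bt b y t \<partial>(gibbs \<pi> \<beta> (pen_risk_est \<sigma> A bt b pen y)))"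

definition ewa_gamma :: "real \<Rightarrow> real \<Rightarrow> real \<Rightarrow> real \<Rightarrow> real" where
  "ewa_gamma \<beta> \<sigma> V \<delta> =
     (if \<delta> = 0 then 0
      else (\<beta> - 4 * \<sigma>\<^sup>2 * V * (1 + 2 * \<delta>)
              - sqrt (\<beta> - 4 * \<sigma>\<^sup>2 * V) * sqrt (\<beta> - 4 * \<sigma>\<^sup>2 * V * (1 + 4 * \<delta>)))
           / (16 * \<sigma>\<^sup>2 * \<delta> * V\<^sup>2))"

definition eps :: "real \<Rightarrow> real \<Rightarrow> real" where
  "eps \<gamma> \<nu> = (1 + \<nu>) / \<nu> * (((1 + \<nu>) * \<gamma>) / (1 - (1 + \<nu>) * \<gamma>))"

definition eps' :: "real \<Rightarrow> real \<Rightarrow> real" where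
  "eps' \<gamma> \<nu> = ((1 + \<nu>) * \<gamma>) / (1 - (1 + \<nu>) * \<gamma>)"

definition nu_set :: "real \<Rightarrow> real set" where
  "nu_set \<gamma> = {\<nu>. \<nu> > 0 \<and> (1 + \<nu>) * \<gamma> < 1}"

(* C stands for tilde_norm T A (f0 - b). *)
definition price ::
  "real \<Rightarrow> real \<Rightarrow> real \<Rightarrow> real \<Rightarrow> ('t \<Rightarrow> real^'n^'n) \<Rightarrow> ('t \<Rightarrow> real^'n) \<Rightarrow> ('t \<Rightarrow> real)
     \<Rightarrow> real \<Rightarrow> 't \<Rightarrow> real" where
  "price \<beta> \<sigma> V \<delta> A bt pen C t =
     pen t + 2 * \<sigma>\<^sup>2 * trace (A t)
     + 8 * \<sigma>\<^sup>2 * (1 - \<delta>) / (\<beta> - 4 * \<sigma>\<^sup>2 * V) * (1 + 2 * ewa_gamma \<beta> \<sigma> V \<delta> * V)\<^sup>2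
         * (C\<^sup>2 * trace (A t ** A t) + (norm (bt t))\<^sup>2)"

end

theory Submission
  imports Defs
begin

text \<open>
  Write \<open>f\<^sub>t\<close> for the estimator with index t, r(t) for its penalised risk estimate, \<open>\<rho>\<close> for the
  Gibbs measure and F for the aggregate. The aggregate is compared with a second, independent
  index u by means of
    g(t,u) = 2 W . (\<open>f\<^sub>t\<close> - \<open>f\<^sub>u\<close>) - \<open>\<gamma>\<close> |\<open>f\<^sub>t\<close> - \<open>f\<^sub>u\<close>|^2 - 2 \<open>\<sigma>\<close>^2 Tr(\<open>A\<^sub>t\<close>) - pen(t) - extra(u),
  where extra(u) = price(u) - pen(u) - 2 \<open>\<sigma>\<close>^2 Tr(\<open>A\<^sub>u\<close>). The theorem rests on two facts about g.

  Probabilistic part: E exp(g(t,u)/\<open>\<beta>\<close>) \<open>\<le>\<close> 1 for all fixed t and u (lemma \<open>expectation_excess\<close>). Here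
  \<open>f\<^sub>t\<close> - \<open>f\<^sub>u\<close> = (\<open>A\<^sub>t\<close> - \<open>A\<^sub>u\<close>) W + m with a deterministic m. As \<open>A\<^sub>u\<close> is positive
  semi-definite, the quadratic form of \<open>A\<^sub>t\<close> - \<open>A\<^sub>u\<close> is at most that of \<open>A\<^sub>t\<close>, whose exponential
  moment is bounded by diagonalising \<open>A\<^sub>t\<close> and writing each exp(c x^2) as a Gaussian average of
  exponentials that are linear in x (lemma \<open>subgaussian_psd_quadratic\<close>); this produces the terms in
  Tr(\<open>A\<^sub>t\<close>) and Tr(\<open>A\<^sub>t\<close>^2). The linear part leaves a multiple of |m|^2, of which a fraction \<open>\<delta>\<close> is
  absorbed by - \<open>\<gamma>\<close> |m|^2 and the rest is paid for by pen(t) and extra(u); the value of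
  \<open>\<gamma>\<close> is the root of the quadratic equation that balances this split (lemma \<open>ewa_gamma_root\<close>).

  Deterministic part (lemmas \<open>gibbs_aggregate_bound\<close> and \<open>pointwise_oracle\<close>): one has
    g(t,u) + r(t) - r(u) = |\<open>f\<^sub>0\<close> - \<open>f\<^sub>t\<close>|^2 - |\<open>f\<^sub>0\<close> - \<open>f\<^sub>u\<close>|^2 - \<open>\<gamma>\<close> |\<open>f\<^sub>t\<close> - \<open>f\<^sub>u\<close>|^2 - price(u),
  free of noise. Rewriting the integral of exp(g/\<open>\<beta>\<close>) over t as one against \<open>\<rho>\<close>, Jensen's inequality
  and the bias-variance decomposition bring in |\<open>f\<^sub>0\<close> - F|^2. The Cauchy-Schwarz inequality in u
  removes r(u) against the normalising constant of \<open>\<rho>\<close>, at the price of halving the exponent, and the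
  Donsker-Varadhan inequality replaces the prior by an arbitrary \<open>\<mu>\<close>; the halving is the reason for
  the factor 2 in front of KL. The divergence of \<open>\<rho>\<close> itself never appears.

  Both bounds then follow from the single random variable \<open>\<Phi>\<close>, the double prior integral of exp(g/\<open>\<beta>\<close>),
  which has mean at most 1: Markov's inequality for \<open>\<Phi>\<close> gives an event that serves all \<open>\<nu>\<close> and \<open>\<mu>\<close> at
  once, and ln \<open>\<Phi>\<close> \<open>\<le>\<close> \<open>\<Phi>\<close> - 1 gives the bound in expectation.
\<close>

section \<open>Orthonormal eigenbases of positive semi-definite matrices\<close>

text \<open>A maximiser e of the quadratic form on the unit sphere of S is an eigenvector, since with the
maximal value l the form l |x|^2 - x . f x is nonnegative on S and vanishes at e. The orthogonal
complement of e in S is again invariant, which allows induction on the dimension.\<close>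

lemma self_adjoint_orthonormal_eigenbasis_on:
  fixes f :: "'a::euclidean_space \<Rightarrow> 'a"
  assumes lin: "linear f" and sa: "\<And>x y. x \<bullet> f y = f x \<bullet> y"
    and "subspace S" and "f ` S \<subseteq> S"
  shows "\<exists>B\<subseteq>S. pairwise orthogonal B \<and> (\<forall>e\<in>B. norm e = 1 \<and> (\<exists>l. f e = l *\<^sub>R e)) \<and> span B = S"
  using assms(3,4)
proof (induction "dim S" arbitrary: S rule: less_induct)
  case less
  note S = less.prems(1) and inv = less.prems(2)
  show ?case
  proof (cases "S = {0}")
    case True
    then show ?thesis by (intro exI[of _ "{}"]) auto
  next
    case False
    then obtain x0 where x0: "x0 \<in> S" "x0 \<noteq> 0" using S subspace_0 by blast
    define K where "K = S \<inter> sphere 0 1"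
    have "compact K" unfolding K_def
      using S by (simp add: closed_Int_compact closed_subspace)
    moreover have "x0 /\<^sub>R norm x0 \<in> K" using x0 S by (simp add: K_def subspace_scale)
    moreover have "continuous_on K (\<lambda>x. x \<bullet> f x)"
      using lin by (intro continuous_intros linear_continuous_on) (simp add: linear_conv_bounded_linear)
    ultimately obtain e where e: "e \<in> K" and max: "\<And>x. x \<in> K \<Longrightarrow> x \<bullet> f x \<le> e \<bullet> f e"
      using continuous_attains_sup[of K "\<lambda>x. x \<bullet> f x"] by blast
    define l where "l = e \<bullet> f e"
    have eS: "e \<in> S" and ne: "norm e = 1" using e by (auto simp: K_def)
    have bound: "y \<bullet> f y \<le> l * (y \<bullet> y)" if "y \<in> S" for y
    proof (cases "y = 0")
      case False
      have "y /\<^sub>R norm y \<in> K" using False that S by (simp add: K_def subspace_scale)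
      from max[OF this] have "inverse (norm y) * (inverse (norm y) * (y \<bullet> f y)) \<le> l"
        by (simp add: l_def linear_scale[OF lin])
      then show ?thesis using False
        by (simp add: field_simps power2_eq_square dot_square_norm)
    qed simp
    have fe: "f e = l *\<^sub>R e"
    proof -
      define y where "y = f e - l *\<^sub>R e"
      have yS: "y \<in> S" unfolding y_def using eS S inv
        by (auto intro!: subspace_diff subspace_scale)
      \<comment> \<open>Perturbing e by a multiple of the residual y shows that the first-order term vanishes.\<close>
      have q: "2 * r * (y \<bullet> y) \<le> r\<^sup>2 * (l * (y \<bullet> y) - y \<bullet> f y)" for r
      proof -
        have "e + r *\<^sub>R y \<in> S" using eS yS S by (auto intro!: subspace_add subspace_scale)
        from bound[OF this]
        have "e \<bullet> f e + r * (e \<bullet> f y) + r * (y \<bullet> f e) + r * r * (y \<bullet> f y)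
            \<le> l * (e \<bullet> e + 2 * r * (e \<bullet> y) + r * r * (y \<bullet> y))"
          by (simp add: linear_add[OF lin] linear_scale[OF lin] algebra_simps inner_commute)
        moreover have "e \<bullet> f y = y \<bullet> f e" using sa[of e y] by (simp add: inner_commute)
        moreover have "y \<bullet> f e = y \<bullet> y + l * (e \<bullet> y)"
          unfolding y_def by (simp add: algebra_simps inner_commute)
        moreover have "e \<bullet> e = 1" using ne by (simp add: dot_square_norm)
        ultimately show ?thesis by (simp add: l_def[symmetric] algebra_simps power2_eq_square)
      qed
      have "y \<bullet> y = 0"
      proof (rule ccontr)
        assume "y \<bullet> y \<noteq> 0"
        then have pos: "y \<bullet> y > 0" by (metis inner_ge_zero order_le_less)
        define q0 where "q0 = l * (y \<bullet> y) - y \<bullet> f y"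
        \<comment> \<open>small enough for the quadratic term to stay below half of the linear one\<close>
        define r where "r = (y \<bullet> y) / (\<bar>q0\<bar> + 1)"
        have r: "r > 0" using pos by (simp add: r_def)
        have "2 * (y \<bullet> y) \<le> r * q0" using q[of r] r
          by (simp add: q0_def[symmetric] power2_eq_square)
        also have "\<dots> \<le> y \<bullet> y"
        proof -
          have "r * q0 \<le> r * (\<bar>q0\<bar> + 1)" using r by (intro mult_left_mono) auto
          then show ?thesis by (simp add: r_def)
        qed
        finally show False using pos by simp
      qed
      then show ?thesis by (simp add: y_def)
    qed
    define S' where "S' = S \<inter> {y. e \<bullet> y = 0}"
    have S': "subspace S'" unfolding S'_def
      using S by (intro subspace_inter subspace_hyperplane) auto
    have inv': "f ` S' \<subseteq> S'"
      using inv sa[of e] by (auto simp: S'_def fe image_subset_iff)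
    have "e \<notin> S'" using ne by (auto simp: S'_def norm_eq_1)
    then have "S' \<subset> S" using eS unfolding S'_def by blast
    then have "dim S' < dim S" using S S' by (intro dim_psubset) (metis span_eq_iff)
    from less.hyps[OF this S' inv'] obtain B where
      B: "B \<subseteq> S'" "pairwise orthogonal B" "span B = S'"
        "\<And>e. e \<in> B \<Longrightarrow> norm e = 1 \<and> (\<exists>l. f e = l *\<^sub>R e)"
      by blast
    show ?thesis
    proof (intro exI[of _ "insert e B"] conjI)
      show "insert e B \<subseteq> S" using eS B(1) by (auto simp: S'_def)
      show "pairwise orthogonal (insert e B)"
        using B(1,2) by (auto simp: pairwise_insert S'_def orthogonal_def inner_commute)
      show "\<forall>e\<in>insert e B. norm e = 1 \<and> (\<exists>l. f e = l *\<^sub>R e)"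
        using B(4) ne fe by auto
      show "span (insert e B) = S"
      proof
        show "span (insert e B) \<subseteq> S" using \<open>insert e B \<subseteq> S\<close> S by (rule span_minimal)
        show "S \<subseteq> span (insert e B)"
        proof
          fix y assume y: "y \<in> S"
          have "y - (e \<bullet> y) *\<^sub>R e \<in> S'"
            using y eS S ne by (auto simp: S'_def inner_diff_right dot_square_norm intro!: subspace_diff subspace_scale)
          then have "y - (e \<bullet> y) *\<^sub>R e \<in> span B" by (simp add: B(3))
          then show "y \<in> span (insert e B)" by (auto simp: span_insert)
        qed
      qed
    qed
  qed
qed

definition orthonormal_basis :: "'a::euclidean_space set \<Rightarrow> bool" where
  "orthonormal_basis B \<longleftrightarrow> finite B \<and> pairwise orthogonal B \<and> (\<forall>e\<in>B. norm e = 1) \<and> span B = UNIV"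

lemma orthonormal_basis_parseval:
  assumes "orthonormal_basis B" shows "(\<Sum>e\<in>B. (e \<bullet> x) * (e \<bullet> y)) = x \<bullet> y"
proof -
  have "x = (\<Sum>e\<in>B. (e \<bullet> x) *\<^sub>R e)"
    using assms orthonormal_basis_expand[of B x] by (auto simp: orthonormal_basis_def inner_commute)
  then have "x \<bullet> y = (\<Sum>e\<in>B. (e \<bullet> x) *\<^sub>R e) \<bullet> y" by metis
  then show ?thesis by (simp add: inner_sum_left)
qed

text \<open>The basis vectors enter only through the sums over e of \<open>e\<^sub>i e\<^sub>j\<close>, which Parseval's identity for
the coordinate axes i and j evaluates.\<close>

lemma trace_orthonormal_basis:
  fixes M :: "real^'n^'n"
  assumes "orthonormal_basis B" shows "trace M = (\<Sum>e\<in>B. e \<bullet> (M *v e))"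
proof -
  have "(\<Sum>e\<in>B. e \<bullet> (M *v e)) = (\<Sum>e\<in>B. \<Sum>i\<in>UNIV. \<Sum>j\<in>UNIV. M$i$j * (e$i * e$j))"
    by (simp add: inner_vec_def matrix_vector_mult_def sum_distrib_left mult_ac)
  also have "\<dots> = (\<Sum>i\<in>UNIV. \<Sum>j\<in>UNIV. M$i$j * (\<Sum>e\<in>B. e$i * e$j))"
    by (subst sum.swap, rule sum.cong[OF refl], subst sum.swap) (simp add: sum_distrib_left)
  also have "\<dots> = (\<Sum>i\<in>UNIV. \<Sum>j\<in>UNIV. M$i$j * (if i = j then 1 else 0))"
  proof -
    have "(\<Sum>e\<in>B. e$i * e$j) = (if i = j then 1 else 0)" for i j :: 'n
    proof -
      have "(\<Sum>e\<in>B. e$i * e$j) = axis i 1 \<bullet> (axis j 1 :: real^'n)"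
        using orthonormal_basis_parseval[OF assms, of "axis i 1" "axis j 1"] by (simp add: inner_axis)
      then show ?thesis by (simp add: inner_axis_axis)
    qed
    then show ?thesis by simp
  qed
  finally show ?thesis by (simp add: trace_def if_distrib sum.delta cong: if_cong)
qed

lemma sym_psd_inner_swap:
  assumes "sym_psd A" shows "x \<bullet> (A *v y) = (A *v x) \<bullet> y"
  using assms unfolding sym_psd_def by (metis dot_lmul_matrix vector_transpose_matrix)

lemma sym_psd_eigenbasis:
  fixes A :: "real^'n^'n"
  assumes "sym_psd A"
  obtains B l where "orthonormal_basis B" "\<And>e. e \<in> B \<Longrightarrow> A *v e = l e *\<^sub>R e"
    "\<And>e. e \<in> B \<Longrightarrow> 0 \<le> l e" "\<And>e. e \<in> B \<Longrightarrow> l e \<le> spectral_norm A"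
    "trace A = (\<Sum>e\<in>B. l e)" "trace (A ** A) = (\<Sum>e\<in>B. (l e)\<^sup>2)"
proof -
  obtain B where B: "pairwise orthogonal B" "\<And>e. e \<in> B \<Longrightarrow> norm e = 1 \<and> (\<exists>l. A *v e = l *\<^sub>R e)"
    "span B = UNIV"
    using self_adjoint_orthonormal_eigenbasis_on[of "(*v) A" UNIV] sym_psd_inner_swap[OF assms]
    by auto
  then obtain l where l: "\<And>e. e \<in> B \<Longrightarrow> A *v e = l e *\<^sub>R e" by metis
  have fin: "finite B"
    using B by (intro independent_imp_finite pairwise_orthogonal_independent) force+
  have basis: "orthonormal_basis B" using B fin by (auto simp: orthonormal_basis_def)
  have le: "l e = e \<bullet> (A *v e)" if "e \<in> B" for e
    using l[OF that] B(2)[OF that] by (simp add: dot_square_norm)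
  show ?thesis
  proof
    show "orthonormal_basis B" by fact
    show "A *v e = l e *\<^sub>R e" if "e \<in> B" for e using l that .
    show "0 \<le> l e" if "e \<in> B" for e using le that assms by (simp add: sym_psd_def)
    show "l e \<le> spectral_norm A" if "e \<in> B" for e
    proof -
      have "norm (A *v e) \<le> onorm ((*v) A) * norm e" by (intro onorm) simp
      then show ?thesis using B(2)[OF that] l[OF that] by (simp add: spectral_norm_def)
    qed
    show "trace A = (\<Sum>e\<in>B. l e)" using trace_orthonormal_basis[OF basis, of A] le by simp
    show "trace (A ** A) = (\<Sum>e\<in>B. (l e)\<^sup>2)"
      unfolding trace_orthonormal_basis[OF basis]
    proof (rule sum.cong[OF refl])
      fix e assume e: "e \<in> B"
      have "(A ** A) *v e = l e *\<^sub>R l e *\<^sub>R e"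
        by (simp add: matrix_vector_mul_assoc[symmetric] l[OF e] matrix_vector_mult_scaleR)
      then show "e \<bullet> ((A ** A) *v e) = (l e)\<^sup>2"
        using B(2)[OF e] by (simp add: dot_square_norm power2_eq_square)
    qed
  qed
qed

section \<open>Exponential moments of quadratic forms in sub-Gaussian noise\<close>

text \<open>Completing the square turns the integrand into a multiple of the normal density with mean
p / (1 - 2 q) and variance 1 / (1 - 2 q). With q = 0 this is the linearisation of exp(p^2 / 2).\<close>

lemma gaussian_exp_quadratic:
  fixes p q :: real
  assumes "q < 1 / 2"
  shows "(\<integral>\<^sup>+z. ennreal (std_normal_density z * exp (p * z + q * z\<^sup>2)) \<partial>lborel)
    = ennreal (exp (p\<^sup>2 / (2 * (1 - 2 * q))) / sqrt (1 - 2 * q))"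
proof -
  define d where "d = 1 - 2 * q"
  have d: "d > 0" using assms by (simp add: d_def)
  define c where "c = exp (p\<^sup>2 / (2 * d)) / sqrt d"
  have eq: "std_normal_density z * exp (p * z + q * z\<^sup>2) = c * normal_density (p / d) (1 / sqrt d) z" for z
  proof -
    have "- z\<^sup>2 / 2 + (p * z + q * z\<^sup>2) = p\<^sup>2 / (2 * d) + - (z - p / d)\<^sup>2 / (2 * (1 / sqrt d)\<^sup>2)"
      using d by (simp add: power_divide power2_diff field_simps) (simp add: d_def power2_eq_square algebra_simps)
    then have "exp (- z\<^sup>2 / 2) * exp (p * z + q * z\<^sup>2)
        = exp (p\<^sup>2 / (2 * d)) * exp (- (z - p / d)\<^sup>2 / (2 * (1 / sqrt d)\<^sup>2))"
      by (metis exp_add)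
    moreover have "sqrt (2 * pi * (1 / sqrt d)\<^sup>2) = sqrt (2 * pi) / sqrt d"
      using d by (simp add: power_divide real_sqrt_divide)
    ultimately show ?thesis using d
      by (simp add: std_normal_density_def normal_density_def c_def)
  qed
  have "c \<ge> 0" using d by (simp add: c_def)
  have "(\<integral>\<^sup>+z. ennreal (normal_density (p / d) (1 / sqrt d) z) \<partial>lborel) = 1"
    using d by (subst nn_integral_eq_integral) auto
  then have "(\<integral>\<^sup>+z. ennreal (std_normal_density z * exp (p * z + q * z\<^sup>2)) \<partial>lborel) = ennreal c"
    unfolding eq using \<open>c \<ge> 0\<close> by (simp add: ennreal_mult nn_integral_cmult)
  then show ?thesis by (simp only: c_def d_def)
qed

text \<open>The noise is only controlled through exponentials of linear forms, so the quadratic terms are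
linearised one direction at a time: exp(c (e . W)^2) is the average of exp(sqrt(2c) z (e . W)) over a
standard normal z. This shifts a by a multiple of e, which the other directions of S do not see by
orthogonality; the general a in the statement makes the induction possible. The result is what a
Gaussian W with covariance \<open>\<sigma>\<close>^2 times the identity would give.\<close>

lemma subgaussian_diagonal_quadratic:
  fixes P :: "'w measure" and W :: "'w \<Rightarrow> real^'n"
  assumes P: "prob_space P" and W: "subgaussian_noise P \<sigma> W"
    and "finite S" and "pairwise orthogonal S" and "\<And>e. e \<in> S \<Longrightarrow> norm e = 1"
    and "\<And>e. e \<in> S \<Longrightarrow> 0 \<le> c e" and "\<And>e. e \<in> S \<Longrightarrow> 2 * \<sigma>\<^sup>2 * c e < 1"
  shows "(\<integral>\<^sup>+\<omega>. ennreal (exp (a \<bullet> W \<omega> + (\<Sum>e\<in>S. c e * (e \<bullet> W \<omega>)\<^sup>2))) \<partial>P)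
    \<le> ennreal (exp (\<sigma>\<^sup>2 / 2 * ((norm a)\<^sup>2 + (\<Sum>e\<in>S. (1 / (1 - 2 * \<sigma>\<^sup>2 * c e) - 1) * (e \<bullet> a)\<^sup>2)))
        / (\<Prod>e\<in>S. sqrt (1 - 2 * \<sigma>\<^sup>2 * c e)))"
  using assms(3-7)
proof (induction S arbitrary: a rule: finite_induct)
  case empty
  then show ?case using W by (simp add: subgaussian_noise_def)
next
  case (insert e S)
  interpret P: prob_space P by fact
  interpret pair: pair_sigma_finite P "lborel :: real measure" by unfold_locales
  have [measurable]: "W \<in> borel_measurable P"
    using W by (auto simp: subgaussian_noise_def has_bochner_integral_iff)
  have ne: "norm e = 1" and ce: "0 \<le> c e" "2 * \<sigma>\<^sup>2 * c e < 1" using insert.prems by auto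
  have ort: "e' \<bullet> e = 0" if "e' \<in> S" for e'
    using insert.prems(1) insert.hyps(2) that by (auto simp: pairwise_insert orthogonal_def)
  define k where "k = sqrt (2 * c e)"
  have k2: "k\<^sup>2 = 2 * c e" using ce by (simp add: k_def)
  define R where "R = (\<Sum>e\<in>S. (1 / (1 - 2 * \<sigma>\<^sup>2 * c e) - 1) * (e \<bullet> a)\<^sup>2)"
  define K where "K = (\<Prod>e\<in>S. sqrt (1 - 2 * \<sigma>\<^sup>2 * c e))"
  have K: "K > 0" unfolding K_def using insert.prems(4) by (intro prod_pos) auto
  define d where "d = 1 - 2 * \<sigma>\<^sup>2 * c e"
  have d: "d > 0" using ce by (simp add: d_def)
  let ?s = "\<lambda>w. \<Sum>e\<in>S. c e * (e \<bullet> w)\<^sup>2"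
  have lin: "ennreal (exp (a \<bullet> w + (\<Sum>e\<in>insert e S. c e * (e \<bullet> w)\<^sup>2)))
      = (\<integral>\<^sup>+z. ennreal (std_normal_density z) * ennreal (exp ((a + (k * z) *\<^sub>R e) \<bullet> w + ?s w)) \<partial>lborel)" for w
  proof -
    have "exp (a \<bullet> w + (\<Sum>e\<in>insert e S. c e * (e \<bullet> w)\<^sup>2))
        = exp (a \<bullet> w + ?s w) * exp ((k * (e \<bullet> w))\<^sup>2 / 2)"
      using insert.hyps by (simp add: power_mult_distrib k2 exp_add[symmetric] algebra_simps)
    also have "ennreal \<dots> = ennreal (exp (a \<bullet> w + ?s w)) *
        (\<integral>\<^sup>+z. ennreal (std_normal_density z * exp (k * (e \<bullet> w) * z + 0 * z\<^sup>2)) \<partial>lborel)"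
      by (subst gaussian_exp_quadratic) (simp_all add: ennreal_mult)
    also have "\<dots> = (\<integral>\<^sup>+z. ennreal (std_normal_density z) * ennreal (exp ((a + (k * z) *\<^sub>R e) \<bullet> w + ?s w)) \<partial>lborel)"
      by (subst nn_integral_cmult[symmetric])
        (auto intro!: nn_integral_cong simp: ennreal_mult[symmetric] inner_add_left exp_add mult_ac)
    finally show ?thesis .
  qed
  have IH: "(\<integral>\<^sup>+\<omega>. ennreal (exp ((a + (k * z) *\<^sub>R e) \<bullet> W \<omega> + ?s (W \<omega>))) \<partial>P)
      \<le> ennreal (exp (\<sigma>\<^sup>2 / 2 * ((norm a)\<^sup>2 + R)) / K) * ennreal (exp (\<sigma>\<^sup>2 * k * (e \<bullet> a) * z + \<sigma>\<^sup>2 * c e * z\<^sup>2))" for z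
  proof -
    have n: "(norm (a + (k * z) *\<^sub>R e))\<^sup>2 = (norm a)\<^sup>2 + 2 * k * z * (e \<bullet> a) + 2 * c e * z\<^sup>2"
    proof -
      have "(norm (a + (k * z) *\<^sub>R e))\<^sup>2 = (norm a)\<^sup>2 + 2 * k * z * (e \<bullet> a) + k\<^sup>2 * z\<^sup>2 * (norm e)\<^sup>2"
        unfolding power2_norm_eq_inner
        by (simp add: algebra_simps inner_commute power2_eq_square)
      then show ?thesis by (simp add: k2 ne)
    qed
    have "(\<integral>\<^sup>+\<omega>. ennreal (exp ((a + (k * z) *\<^sub>R e) \<bullet> W \<omega> + ?s (W \<omega>))) \<partial>P)
      \<le> ennreal (exp (\<sigma>\<^sup>2 / 2 * ((norm (a + (k * z) *\<^sub>R e))\<^sup>2 + R)) / K)"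
      using insert.IH[of "a + (k * z) *\<^sub>R e"] insert.prems
      by (simp add: pairwise_insert inner_add_right ort R_def K_def)
    also have "exp (\<sigma>\<^sup>2 / 2 * ((norm (a + (k * z) *\<^sub>R e))\<^sup>2 + R)) / K
        = exp (\<sigma>\<^sup>2 / 2 * ((norm a)\<^sup>2 + R)) / K * exp (\<sigma>\<^sup>2 * k * (e \<bullet> a) * z + \<sigma>\<^sup>2 * c e * z\<^sup>2)"
      unfolding n by (simp add: exp_add[symmetric] algebra_simps)
    finally show ?thesis using K by (subst ennreal_mult[symmetric]) auto
  qed
  have "(\<integral>\<^sup>+\<omega>. ennreal (exp (a \<bullet> W \<omega> + (\<Sum>e\<in>insert e S. c e * (e \<bullet> W \<omega>)\<^sup>2))) \<partial>P)
      = (\<integral>\<^sup>+\<omega>. (\<integral>\<^sup>+z. ennreal (std_normal_density z) * ennreal (exp ((a + (k * z) *\<^sub>R e) \<bullet> W \<omega> + ?s (W \<omega>))) \<partial>lborel) \<partial>P)"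
    unfolding lin ..
  also have "\<dots> = (\<integral>\<^sup>+z. (\<integral>\<^sup>+\<omega>. ennreal (std_normal_density z) * ennreal (exp ((a + (k * z) *\<^sub>R e) \<bullet> W \<omega> + ?s (W \<omega>))) \<partial>P) \<partial>lborel)"
    by (intro pair.Fubini'[symmetric]) measurable
  also have "\<dots> = (\<integral>\<^sup>+z. ennreal (std_normal_density z) * (\<integral>\<^sup>+\<omega>. ennreal (exp ((a + (k * z) *\<^sub>R e) \<bullet> W \<omega> + ?s (W \<omega>))) \<partial>P) \<partial>lborel)"
    by (intro nn_integral_cong nn_integral_cmult) measurable
  also have "\<dots> \<le> (\<integral>\<^sup>+z. ennreal (std_normal_density z) * (ennreal (exp (\<sigma>\<^sup>2 / 2 * ((norm a)\<^sup>2 + R)) / K)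
      * ennreal (exp (\<sigma>\<^sup>2 * k * (e \<bullet> a) * z + \<sigma>\<^sup>2 * c e * z\<^sup>2))) \<partial>lborel)"
    by (intro nn_integral_mono mult_left_mono IH) auto
  also have "\<dots> = ennreal (exp (\<sigma>\<^sup>2 / 2 * ((norm a)\<^sup>2 + R)) / K) *
      (\<integral>\<^sup>+z. ennreal (std_normal_density z * exp (\<sigma>\<^sup>2 * k * (e \<bullet> a) * z + \<sigma>\<^sup>2 * c e * z\<^sup>2)) \<partial>lborel)"
    by (subst nn_integral_cmult[symmetric]) (auto intro!: nn_integral_cong simp: ennreal_mult mult_ac)
  also have "\<dots> = ennreal (exp (\<sigma>\<^sup>2 / 2 * ((norm a)\<^sup>2 + R)) / K * (exp ((\<sigma>\<^sup>2 * k * (e \<bullet> a))\<^sup>2 / (2 * d)) / sqrt d))"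
  proof -
    have "(\<integral>\<^sup>+z. ennreal (std_normal_density z * exp (\<sigma>\<^sup>2 * k * (e \<bullet> a) * z + \<sigma>\<^sup>2 * c e * z\<^sup>2)) \<partial>lborel)
        = ennreal (exp ((\<sigma>\<^sup>2 * k * (e \<bullet> a))\<^sup>2 / (2 * d)) / sqrt d)"
      using gaussian_exp_quadratic[of "\<sigma>\<^sup>2 * c e" "\<sigma>\<^sup>2 * k * (e \<bullet> a)"] ce(2)
      by (simp add: d_def mult.assoc)
    then show ?thesis using K d by (simp only:) (rule ennreal_mult[symmetric]; simp)
  qed
  also have "exp (\<sigma>\<^sup>2 / 2 * ((norm a)\<^sup>2 + R)) / K * (exp ((\<sigma>\<^sup>2 * k * (e \<bullet> a))\<^sup>2 / (2 * d)) / sqrt d)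
      = exp (\<sigma>\<^sup>2 / 2 * ((norm a)\<^sup>2 + R) + (\<sigma>\<^sup>2 * k * (e \<bullet> a))\<^sup>2 / (2 * d)) / (sqrt d * K)"
    by (simp add: exp_add)
  also have "\<sigma>\<^sup>2 / 2 * ((norm a)\<^sup>2 + R) + (\<sigma>\<^sup>2 * k * (e \<bullet> a))\<^sup>2 / (2 * d)
      = \<sigma>\<^sup>2 / 2 * ((norm a)\<^sup>2 + (\<Sum>e\<in>insert e S. (1 / (1 - 2 * \<sigma>\<^sup>2 * c e) - 1) * (e \<bullet> a)\<^sup>2))"
  proof -
    have "1 / d - 1 = \<sigma>\<^sup>2 * k\<^sup>2 / d" using d by (simp add: k2 field_simps) (simp add: d_def)
    then have "(\<sigma>\<^sup>2 * k * (e \<bullet> a))\<^sup>2 / (2 * d) = \<sigma>\<^sup>2 / 2 * ((1 / d - 1) * (e \<bullet> a)\<^sup>2)"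
      by (simp add: power2_eq_square)
    then show ?thesis using insert.hyps
      by (simp add: d_def[symmetric] R_def[symmetric] distrib_left)
  qed
  also have "sqrt d * K = (\<Prod>e\<in>insert e S. sqrt (1 - 2 * \<sigma>\<^sup>2 * c e))"
    using insert.hyps by (simp add: d_def K_def)
  finally show ?case .
qed

text \<open>This turns the inverse square root of the determinant in the Gaussian formula into a trace and a trace
of a square. The function h in the proof, four times the gap between the logarithms, has derivative (x / (1 - x))^2.\<close>

lemma inverse_sqrt_le_exp:
  fixes x :: real
  assumes "0 \<le> x" "x < 1"
  shows "1 / sqrt (1 - x) \<le> exp (x / 2 + x\<^sup>2 / (4 * (1 - x)))"
proof -
  define h where "h = (\<lambda>x::real. 2 * x + x\<^sup>2 / (1 - x) + 2 * ln (1 - x))"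
  have "h 0 \<le> h x"
  proof (rule DERIV_nonneg_imp_nondecreasing[OF assms(1)])
    fix y assume y: "0 \<le> y" "y \<le> x"
    then have y1: "1 - y > 0" using assms by simp
    have "(h has_real_derivative (2 + (2 * y * (1 - y) + y\<^sup>2) / ((1 - y) * (1 - y)) - 2 / (1 - y))) (at y)"
      unfolding h_def using y1
      by (auto intro!: derivative_eq_intros)
    moreover have "2 + (2 * y * (1 - y) + y\<^sup>2) / ((1 - y) * (1 - y)) - 2 / (1 - y) = (y / (1 - y))\<^sup>2"
      using y1 by (simp add: divide_simps power2_eq_square) (simp add: algebra_simps)
    ultimately show "\<exists>D. (h has_real_derivative D) (at y) \<and> D \<ge> 0"
      by (metis zero_le_power2)
  qed
  then have "- ln (1 - x) / 2 \<le> x / 2 + x\<^sup>2 / (4 * (1 - x))"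
    using assms by (simp add: h_def field_simps)
  moreover have "ln (1 / sqrt (1 - x)) = - ln (1 - x) / 2"
    using assms by (simp add: ln_div ln_sqrt)
  ultimately show ?thesis
    using assms by (metis diff_gt_0_iff_gt divide_pos_pos exp_le_cancel_iff exp_ln real_sqrt_gt_zero zero_less_one)
qed

text \<open>In an eigenbasis of A with eigenvalues l(e), the diagonal bound applies with c(e) = 2 l(e) / \<open>\<beta>\<close>. All
the numbers x(e) = 4 \<open>\<sigma>\<close>^2 l(e) / \<open>\<beta>\<close> stay away from 1 by at least (\<open>\<beta>\<close> - 4 \<open>\<sigma>\<close>^2 V) / \<open>\<beta>\<close>, which is where the
denominators on the right-hand side come from.\<close>

lemma subgaussian_psd_quadratic:
  fixes P :: "'w measure" and W :: "'w \<Rightarrow> real^'n" and A :: "real^'n^'n"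
  assumes P: "prob_space P" and W: "subgaussian_noise P \<sigma> W"
    and A: "sym_psd A" "spectral_norm A \<le> V" and "0 < \<beta>" and \<beta>: "4 * \<sigma>\<^sup>2 * V < \<beta>"
  shows "(\<integral>\<^sup>+\<omega>. ennreal (exp ((2 * (W \<omega> \<bullet> (A *v W \<omega>)) + 2 * (a \<bullet> W \<omega>)) / \<beta>)) \<partial>P)
    \<le> ennreal (exp ((2 * \<sigma>\<^sup>2 * trace A + 4 * \<sigma>\<^sup>2 / (\<beta> - 4 * \<sigma>\<^sup>2 * V) * (\<sigma>\<^sup>2 * trace (A ** A))
        + 2 * \<sigma>\<^sup>2 / (\<beta> - 4 * \<sigma>\<^sup>2 * V) * (norm a)\<^sup>2) / \<beta>))"
proof -
  obtain B l where B: "orthonormal_basis B" and l: "\<And>e. e \<in> B \<Longrightarrow> A *v e = l e *\<^sub>R e"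
    and l0: "\<And>e. e \<in> B \<Longrightarrow> 0 \<le> l e" and lV: "\<And>e. e \<in> B \<Longrightarrow> l e \<le> spectral_norm A"
    and tr: "trace A = (\<Sum>e\<in>B. l e)" "trace (A ** A) = (\<Sum>e\<in>B. (l e)\<^sup>2)"
    by (rule sym_psd_eigenbasis[OF A(1)]) (rule that)
  define c where "c = (\<lambda>e. 2 * l e / \<beta>)"
  define x where "x = (\<lambda>e. 2 * \<sigma>\<^sup>2 * c e)"
  define D where "D = \<beta> - 4 * \<sigma>\<^sup>2 * V"
  have D: "D > 0" using \<beta> by (simp add: D_def)
  have x0: "0 \<le> x e" if "e \<in> B" for e using l0[OF that] \<open>0 < \<beta>\<close> by (simp add: x_def c_def)
  have x1: "D / \<beta> \<le> 1 - x e" if "e \<in> B" for e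
  proof -
    have "4 * \<sigma>\<^sup>2 * l e \<le> 4 * \<sigma>\<^sup>2 * V" using lV[OF that] A(2) by (intro mult_left_mono) auto
    then show ?thesis using \<open>0 < \<beta>\<close> by (simp add: x_def c_def D_def field_simps)
  qed
  have Db: "0 < D / \<beta>" using D \<open>0 < \<beta>\<close> by simp
  have x2: "x e < 1" if "e \<in> B" for e using x1[OF that] Db by linarith
  have x3: "1 / (1 - x e) \<le> \<beta> / D" if "e \<in> B" for e
  proof -
    have "1 / (1 - x e) \<le> 1 / (D / \<beta>)" by (rule frac_le) (use x1[OF that] Db in auto)
    then show ?thesis by simp
  qed
  have quad: "w \<bullet> (A *v w) = (\<Sum>e\<in>B. l e * (e \<bullet> w)\<^sup>2)" for w
  proof -
    have "w \<bullet> (A *v w) = (\<Sum>e\<in>B. (e \<bullet> w) * (e \<bullet> (A *v w)))" using orthonormal_basis_parseval[OF B] by simp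
    also have "\<dots> = (\<Sum>e\<in>B. l e * (e \<bullet> w)\<^sup>2)"
      by (intro sum.cong refl) (simp add: sym_psd_inner_swap[OF A(1)] l power2_eq_square)
    finally show ?thesis .
  qed
  have "(\<integral>\<^sup>+\<omega>. ennreal (exp ((2 * (W \<omega> \<bullet> (A *v W \<omega>)) + 2 * (a \<bullet> W \<omega>)) / \<beta>)) \<partial>P)
      = (\<integral>\<^sup>+\<omega>. ennreal (exp (((2 / \<beta>) *\<^sub>R a) \<bullet> W \<omega> + (\<Sum>e\<in>B. c e * (e \<bullet> W \<omega>)\<^sup>2))) \<partial>P)"
    unfolding quad by (simp add: c_def sum_distrib_left sum_divide_distrib add_divide_distrib mult_ac add.commute)
  also have "\<dots> \<le> ennreal (exp (\<sigma>\<^sup>2 / 2 * ((norm ((2 / \<beta>) *\<^sub>R a))\<^sup>2 + (\<Sum>e\<in>B. (1 / (1 - x e) - 1) * (e \<bullet> ((2 / \<beta>) *\<^sub>R a))\<^sup>2)))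
        / (\<Prod>e\<in>B. sqrt (1 - x e)))"
    unfolding x_def using B l0 x2 \<open>0 < \<beta>\<close>
    by (intro subgaussian_diagonal_quadratic[OF P W]) (auto simp: orthonormal_basis_def x_def c_def)
  also have "\<dots> \<le> ennreal (exp ((2 * \<sigma>\<^sup>2 * trace A + 4 * \<sigma>\<^sup>2 / D * (\<sigma>\<^sup>2 * trace (A ** A))
        + 2 * \<sigma>\<^sup>2 / D * (norm a)\<^sup>2) / \<beta>))"
  proof (rule ennreal_leI)
    have lin: "\<sigma>\<^sup>2 / 2 * ((norm ((2 / \<beta>) *\<^sub>R a))\<^sup>2 + (\<Sum>e\<in>B. (1 / (1 - x e) - 1) * (e \<bullet> ((2 / \<beta>) *\<^sub>R a))\<^sup>2))
        \<le> 2 * \<sigma>\<^sup>2 / D * (norm a)\<^sup>2 / \<beta>"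
    proof -
      let ?a = "(2 / \<beta>) *\<^sub>R a"
      have pars: "(norm ?a)\<^sup>2 = (\<Sum>e\<in>B. (e \<bullet> ?a)\<^sup>2)"
        using orthonormal_basis_parseval[OF B, of ?a ?a] by (simp only: power2_eq_square[of "norm _"] power2_eq_square power2_norm_eq_inner[unfolded power2_eq_square])
      have "(norm ?a)\<^sup>2 + (\<Sum>e\<in>B. (1 / (1 - x e) - 1) * (e \<bullet> ?a)\<^sup>2) = (\<Sum>e\<in>B. 1 / (1 - x e) * (e \<bullet> ?a)\<^sup>2)"
        unfolding pars by (simp only: sum.distrib[symmetric]) (simp add: algebra_simps)
      also have "\<dots> \<le> (\<Sum>e\<in>B. \<beta> / D * (e \<bullet> ?a)\<^sup>2)"
        by (intro sum_mono mult_right_mono x3) auto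
      also have "\<dots> = \<beta> / D * (norm ?a)\<^sup>2" unfolding pars by (simp only: sum_distrib_left)
      finally have "\<sigma>\<^sup>2 / 2 * ((norm ?a)\<^sup>2 + (\<Sum>e\<in>B. (1 / (1 - x e) - 1) * (e \<bullet> ?a)\<^sup>2))
          \<le> \<sigma>\<^sup>2 / 2 * (\<beta> / D * (norm ?a)\<^sup>2)" by (intro mult_left_mono) auto
      also have "\<dots> = 2 * \<sigma>\<^sup>2 / D * (norm a)\<^sup>2 / \<beta>"
        using \<open>0 < \<beta>\<close> D by (simp add: field_simps power2_eq_square)
      finally show ?thesis .
    qed
    have det: "1 / (\<Prod>e\<in>B. sqrt (1 - x e)) \<le> exp ((2 * \<sigma>\<^sup>2 * trace A + 4 * \<sigma>\<^sup>2 / D * (\<sigma>\<^sup>2 * trace (A ** A))) / \<beta>)"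
    proof -
      have "1 / (\<Prod>e\<in>B. sqrt (1 - x e)) = (\<Prod>e\<in>B. 1 / sqrt (1 - x e))"
        by (simp add: prod_dividef)
      also have "\<dots> \<le> (\<Prod>e\<in>B. exp ((2 * \<sigma>\<^sup>2 * l e + 4 * \<sigma>\<^sup>2 / D * (\<sigma>\<^sup>2 * (l e)\<^sup>2)) / \<beta>))"
      proof (intro prod_mono conjI)
        fix e assume e: "e \<in> B"
        show "0 \<le> 1 / sqrt (1 - x e)" using x2[OF e] by simp
        have "x e / 2 + (x e)\<^sup>2 / (4 * (1 - x e)) = x e / 2 + (x e)\<^sup>2 / 4 * (1 / (1 - x e))" by simp
        also have "\<dots> \<le> x e / 2 + (x e)\<^sup>2 / 4 * (\<beta> / D)"
          using x3[OF e] by (intro add_left_mono mult_left_mono) auto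
        also have "\<dots> = (2 * \<sigma>\<^sup>2 * l e + 4 * \<sigma>\<^sup>2 / D * (\<sigma>\<^sup>2 * (l e)\<^sup>2)) / \<beta>"
          using \<open>0 < \<beta>\<close> D by (simp add: x_def c_def field_simps power2_eq_square)
        finally show "1 / sqrt (1 - x e) \<le> exp ((2 * \<sigma>\<^sup>2 * l e + 4 * \<sigma>\<^sup>2 / D * (\<sigma>\<^sup>2 * (l e)\<^sup>2)) / \<beta>)"
          using inverse_sqrt_le_exp[OF x0[OF e] x2[OF e]] by (meson exp_le_cancel_iff order_trans)
      qed
      also have "\<dots> = exp (\<Sum>e\<in>B. (2 * \<sigma>\<^sup>2 * l e + 4 * \<sigma>\<^sup>2 / D * (\<sigma>\<^sup>2 * (l e)\<^sup>2)) / \<beta>)"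
        using B by (simp add: exp_sum orthonormal_basis_def)
      also have "(\<Sum>e\<in>B. (2 * \<sigma>\<^sup>2 * l e + 4 * \<sigma>\<^sup>2 / D * (\<sigma>\<^sup>2 * (l e)\<^sup>2)) / \<beta>)
          = (2 * \<sigma>\<^sup>2 * trace A + 4 * \<sigma>\<^sup>2 / D * (\<sigma>\<^sup>2 * trace (A ** A))) / \<beta>"
        by (simp only: tr sum_divide_distrib[symmetric] sum.distrib sum_distrib_left)
      finally show ?thesis .
    qed
    let ?L = "\<sigma>\<^sup>2 / 2 * ((norm ((2 / \<beta>) *\<^sub>R a))\<^sup>2 + (\<Sum>e\<in>B. (1 / (1 - x e) - 1) * (e \<bullet> ((2 / \<beta>) *\<^sub>R a))\<^sup>2))"
    have pp: "0 \<le> 1 / (\<Prod>e\<in>B. sqrt (1 - x e))"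
      using x2 by (intro divide_nonneg_nonneg prod_nonneg) (auto simp: less_imp_le)
    have "exp ?L / (\<Prod>e\<in>B. sqrt (1 - x e)) = exp ?L * (1 / (\<Prod>e\<in>B. sqrt (1 - x e)))" by simp
    also have "\<dots> \<le> exp (2 * \<sigma>\<^sup>2 / D * (norm a)\<^sup>2 / \<beta>) * exp ((2 * \<sigma>\<^sup>2 * trace A + 4 * \<sigma>\<^sup>2 / D * (\<sigma>\<^sup>2 * trace (A ** A))) / \<beta>)"
      using lin det pp by (intro mult_mono) auto
    also have "\<dots> = exp ((2 * \<sigma>\<^sup>2 * trace A + 4 * \<sigma>\<^sup>2 / D * (\<sigma>\<^sup>2 * trace (A ** A)) + 2 * \<sigma>\<^sup>2 / D * (norm a)\<^sup>2) / \<beta>)"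
      by (simp only: exp_add[symmetric]) (simp add: add_divide_distrib add.commute)
    finally show "exp ?L / (\<Prod>e\<in>B. sqrt (1 - x e)) \<le> exp ((2 * \<sigma>\<^sup>2 * trace A + 4 * \<sigma>\<^sup>2 / D * (\<sigma>\<^sup>2 * trace (A ** A)) + 2 * \<sigma>\<^sup>2 / D * (norm a)\<^sup>2) / \<beta>)" .
  qed
  finally show ?thesis unfolding D_def .
qed

section \<open>Jensen, Donsker-Varadhan and the Gibbs measure\<close>

text \<open>The right-hand side is an integral in [0, \<open>\<infinity>\<close>], so that nothing has to be known about the
integrability of exp(f).\<close>

lemma exp_integral_le_nn_integral_exp:
  fixes f :: "'a \<Rightarrow> real"
  assumes "prob_space M" and f: "integrable M f"
  shows "ennreal (exp (\<integral>x. f x \<partial>M)) \<le> (\<integral>\<^sup>+x. ennreal (exp (f x)) \<partial>M)"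
proof (cases "(\<integral>\<^sup>+x. ennreal (exp (f x)) \<partial>M) = \<infinity>")
  case False
  interpret prob_space M by fact
  define c where "c = (\<integral>x. f x \<partial>M)"
  have [measurable]: "f \<in> borel_measurable M" using f by auto
  have int: "integrable M (\<lambda>x. exp (f x))"
    using False by (intro integrableI_nonneg) (auto simp: top.not_eq_extremum)
  have "exp c = (\<integral>x. exp c * (1 + (f x - c)) \<partial>M)"
    using f by (simp add: prob_space c_def)
  also have "\<dots> \<le> (\<integral>x. exp (f x) \<partial>M)"
  proof (intro integral_mono)
    fix x
    have "exp c * (1 + (f x - c)) \<le> exp c * exp (f x - c)"
      by (intro mult_left_mono exp_ge_add_one_self) auto
    then show "exp c * (1 + (f x - c)) \<le> exp (f x)" by (simp add: exp_diff)
  qed (use f int in auto)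
  finally show ?thesis
    using int by (subst nn_integral_eq_integral) (auto simp: c_def)
qed simp

text \<open>The easy half of the Donsker-Varadhan formula: change the measure from \<open>\<pi>\<close> to \<open>\<mu>\<close>, which costs the
density as a factor exp(- L) and loses only the part of \<open>\<pi>\<close> where the density vanishes, and apply
Jensen's inequality under \<open>\<mu>\<close>.\<close>

lemma donsker_varadhan:
  fixes X :: "'t \<Rightarrow> real"
  assumes "prob_space \<pi>" "prob_space \<mu>" and sets: "sets \<mu> = sets \<pi>"
    and [measurable]: "X \<in> borel_measurable \<pi>" and X: "integrable \<mu> X"
    and KL: "KL \<mu> \<pi> \<noteq> \<infinity>"
  shows "ennreal (exp (- (\<integral>t. X t \<partial>\<mu>) - enn2real (KL \<mu> \<pi>))) \<le> (\<integral>\<^sup>+t. ennreal (exp (- X t)) \<partial>\<pi>)"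
proof -
  interpret \<pi>: prob_space \<pi> by fact
  interpret \<mu>: prob_space \<mu> by fact
  define f where "f = RN_deriv \<pi> \<mu>"
  define L where "L = entropy_density (exp 1) \<pi> \<mu>"
  have ac: "absolutely_continuous \<pi> \<mu>" and L: "integrable \<mu> L"
    and KL_eq: "KL \<mu> \<pi> = ennreal (\<integral>t. L t \<partial>\<mu>)"
    using KL by (auto simp: KL_def L_def KL_divergence_def split: if_splits)
  have [measurable]: "f \<in> borel_measurable \<pi>" "L \<in> borel_measurable \<pi>"
    by (auto simp: f_def L_def)
  have dens: "\<mu> = density \<pi> f" unfolding f_def by (rule \<pi>.density_RN_deriv[OF ac sets, symmetric])
  have fin: "AE t in \<pi>. f t \<noteq> \<infinity>"
    unfolding f_def by (rule \<pi>.RN_deriv_finite[OF _ ac sets]) unfold_locales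
  have "- (\<integral>t. X t \<partial>\<mu>) - enn2real (KL \<mu> \<pi>) \<le> (\<integral>t. - X t - L t \<partial>\<mu>)"
    using X L by (cases "0 \<le> (\<integral>t. L t \<partial>\<mu>)") (simp_all add: KL_eq ennreal_neg)
  then have "ennreal (exp (- (\<integral>t. X t \<partial>\<mu>) - enn2real (KL \<mu> \<pi>))) \<le> ennreal (exp (\<integral>t. - X t - L t \<partial>\<mu>))"
    by (intro ennreal_leI) simp
  also have "\<dots> \<le> (\<integral>\<^sup>+t. ennreal (exp (- X t - L t)) \<partial>\<mu>)"
    using X L \<open>prob_space \<mu>\<close> by (intro exp_integral_le_nn_integral_exp) auto
  also have "\<dots> = (\<integral>\<^sup>+t. f t * ennreal (exp (- X t - L t)) \<partial>\<pi>)"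
    by (subst dens, subst nn_integral_density) auto
  also have "\<dots> \<le> (\<integral>\<^sup>+t. ennreal (exp (- X t)) \<partial>\<pi>)"
  proof (rule nn_integral_mono_AE, use fin in eventually_elim)
    fix t assume ft: "f t \<noteq> \<infinity>"
    show "f t * ennreal (exp (- X t - L t)) \<le> ennreal (exp (- X t))"
    proof (cases "f t = 0")
      case False
      define r where "r = enn2real (f t)"
      have r: "f t = ennreal r" "r > 0"
        using ft False by (auto simp: r_def enn2real_positive_iff top.not_eq_extremum zero_less_iff_neq_zero)
      have "L t = ln r" by (simp add: L_def entropy_density_def r_def f_def log_def)
      then show ?thesis using r by (simp add: exp_diff ennreal_mult[symmetric])
    qed simp
  qed
  finally show ?thesis .
qed

text \<open>Bias-variance decomposition; square integrability around one point a suffices.\<close>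

lemma integral_norm_diff_sq:
  fixes f :: "'a \<Rightarrow> 'b::euclidean_space"
  assumes "prob_space M" and f: "integrable M f" and f2: "integrable M (\<lambda>x. (norm (f x - a))\<^sup>2)"
  shows "integrable M (\<lambda>x. (norm (f x - c))\<^sup>2)"
    and "(\<integral>x. (norm (f x - c))\<^sup>2 \<partial>M) = (\<integral>x. (norm (f x - (\<integral>x. f x \<partial>M)))\<^sup>2 \<partial>M) + (norm ((\<integral>x. f x \<partial>M) - c))\<^sup>2"
proof -
  interpret prob_space M by fact
  define F where "F = (\<integral>x. f x \<partial>M)"
  have eq: "(norm (f x - c))\<^sup>2 = (norm (f x - a))\<^sup>2 + 2 * ((f x - a) \<bullet> (a - c)) + (norm (a - c))\<^sup>2" for x a c
    unfolding power2_norm_eq_inner by (simp add: algebra_simps inner_commute)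
  show int: "integrable M (\<lambda>x. (norm (f x - c))\<^sup>2)" for c
    unfolding eq[of _ c a] using f f2 by auto
  have "(\<integral>x. (f x - F) \<bullet> (F - c) \<partial>M) = 0"
    using f by (simp add: F_def prob_space)
  then show "(\<integral>x. (norm (f x - c))\<^sup>2 \<partial>M) = (\<integral>x. (norm (f x - (\<integral>x. f x \<partial>M)))\<^sup>2 \<partial>M) + (norm ((\<integral>x. f x \<partial>M) - c))\<^sup>2"
    unfolding eq[of _ c F] F_def[symmetric] using f int[of F] by (simp add: prob_space)
qed

lemma gibbs_normalizer:
  fixes r :: "'t \<Rightarrow> real" and m \<beta> :: real
  assumes "prob_space \<pi>" and [measurable]: "r \<in> borel_measurable \<pi>" and "0 < \<beta>"
    and lb: "\<And>t. t \<in> space \<pi> \<Longrightarrow> - m \<le> r t"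
  shows "integrable \<pi> (\<lambda>t. exp (- r t / \<beta>))" and "0 < (\<integral>t. exp (- r t / \<beta>) \<partial>\<pi>)"
proof -
  interpret prob_space \<pi> by fact
  have "norm (exp (- r t / \<beta>)) \<le> exp (m / \<beta>)" if "t \<in> space \<pi>" for t
    using divide_right_mono[of "- r t" m \<beta>] lb[OF that] \<open>0 < \<beta>\<close> by simp
  then show int: "integrable \<pi> (\<lambda>t. exp (- r t / \<beta>))"
    by (intro integrable_const_bound[where B = "exp (m / \<beta>)"] AE_I2) auto
  have "(\<integral>t. exp (- r t / \<beta>) \<partial>\<pi>) \<noteq> 0"
  proof
    assume "(\<integral>t. exp (- r t / \<beta>) \<partial>\<pi>) = 0"
    then have "AE t in \<pi>. exp (- r t / \<beta>) = 0"
      using int by (subst (asm) integral_nonneg_eq_0_iff_AE) auto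
    then show False by simp
  qed
  moreover have "0 \<le> (\<integral>t. exp (- r t / \<beta>) \<partial>\<pi>)" by (intro integral_nonneg_AE) auto
  ultimately show "0 < (\<integral>t. exp (- r t / \<beta>) \<partial>\<pi>)" by linarith
qed

lemma gibbs_facts:
  fixes r :: "'t \<Rightarrow> real" and m \<beta> :: real
  assumes \<pi>: "prob_space \<pi>" and r[measurable]: "r \<in> borel_measurable \<pi>" and "0 < \<beta>"
    and lb: "\<And>t. t \<in> space \<pi> \<Longrightarrow> - m \<le> r t"
  shows prob_space_gibbs: "prob_space (gibbs \<pi> \<beta> r)"
    and nn_integral_gibbs: "\<And>g. g \<in> borel_measurable \<pi> \<Longrightarrow>
      (\<integral>\<^sup>+t. g t * ennreal (exp (- r t / \<beta>)) \<partial>\<pi>) = ennreal (\<integral>t. exp (- r t / \<beta>) \<partial>\<pi>) * (\<integral>\<^sup>+t. g t \<partial>gibbs \<pi> \<beta> r)"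
proof -
  define Z where "Z = (\<integral>t. exp (- r t / \<beta>) \<partial>\<pi>)"
  have Z: "0 < Z" and int: "integrable \<pi> (\<lambda>t. exp (- r t / \<beta>))"
    unfolding Z_def using gibbs_normalizer[OF assms] by auto
  show nn: "(\<integral>\<^sup>+t. g t * ennreal (exp (- r t / \<beta>)) \<partial>\<pi>) = ennreal (\<integral>t. exp (- r t / \<beta>) \<partial>\<pi>) * (\<integral>\<^sup>+t. g t \<partial>gibbs \<pi> \<beta> r)"
    if [measurable]: "g \<in> borel_measurable \<pi>" for g
  proof -
    have "ennreal Z * (\<integral>\<^sup>+t. g t \<partial>gibbs \<pi> \<beta> r) = (\<integral>\<^sup>+t. ennreal Z * (ennreal (exp (- r t / \<beta>) / Z) * g t) \<partial>\<pi>)"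
      unfolding gibbs_def Z_def[symmetric]
      by (subst nn_integral_density) (auto simp: nn_integral_cmult)
    also have "\<dots> = (\<integral>\<^sup>+t. g t * ennreal (exp (- r t / \<beta>)) \<partial>\<pi>)"
    proof (rule nn_integral_cong)
      fix t
      have "ennreal Z * ennreal (exp (- r t / \<beta>) / Z) = ennreal (exp (- r t / \<beta>))"
        using Z by (subst ennreal_mult[symmetric]) auto
      then show "ennreal Z * (ennreal (exp (- r t / \<beta>) / Z) * g t) = g t * ennreal (exp (- r t / \<beta>))"
        by (metis mult.assoc mult.commute)
    qed
    finally show ?thesis by (simp add: Z_def)
  qed
  have "(\<integral>\<^sup>+t. ennreal (exp (- r t / \<beta>)) \<partial>\<pi>) = ennreal Z"
    unfolding Z_def using int by (intro nn_integral_eq_integral) auto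
  with nn[of "\<lambda>_. 1"] have "ennreal Z * emeasure (gibbs \<pi> \<beta> r) (space (gibbs \<pi> \<beta> r)) = ennreal Z * 1"
    by (simp add: Z_def)
  then have "emeasure (gibbs \<pi> \<beta> r) (space (gibbs \<pi> \<beta> r)) = 1"
    using Z by (subst (asm) ennreal_mult_cancel_left) auto
  then show "prob_space (gibbs \<pi> \<beta> r)" by (rule prob_spaceI)
qed

text \<open>The deterministic heart of the argument. For fixed u, dividing by exp(- r / \<open>\<beta>\<close>) turns the prior
integral over t into an integral under the Gibbs measure, to which Jensen's inequality applies; r(t)
drops out. Since \<open>\<gamma>\<close> \<open>\<le>\<close> 1, the variance of f under the Gibbs measure absorbs the variance part of
the term with \<open>\<gamma>\<close>, and Young's inequality with parameter \<open>\<nu>\<close> splits the remaining |F - f(u)|^2. The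
normalising constant Z that was split off is itself a prior integral of exp(- r(u) / \<open>\<beta>\<close>), and the
Cauchy-Schwarz inequality multiplies it back in so that r(u) drops out, too. The lower bound on r
makes f square integrable under the Gibbs measure.\<close>

lemma gibbs_aggregate_bound:
  fixes f :: "'t \<Rightarrow> 'a::euclidean_space" and r p :: "'t \<Rightarrow> real" and f0 y :: 'a
  assumes \<pi>: "prob_space \<pi>" and [measurable]: "r \<in> borel_measurable \<pi>" "f \<in> borel_measurable \<pi>" "p \<in> borel_measurable \<pi>"
    and \<beta>: "0 < \<beta>" and lb: "\<And>t. t \<in> space \<pi> \<Longrightarrow> (norm (y - f t))\<^sup>2 - m \<le> r t"
    and \<gamma>: "0 \<le> \<gamma>" "(1 + \<nu>) * \<gamma> < 1" and \<nu>: "0 < \<nu>"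
  defines "F \<equiv> \<integral>t. f t \<partial>gibbs \<pi> \<beta> r"
  defines "X \<equiv> \<lambda>u. (1 + (1 + \<nu>) / \<nu> * \<gamma>) * (norm (f0 - f u))\<^sup>2 + p u"
  shows "(\<integral>\<^sup>+u. ennreal (exp (((1 - (1 + \<nu>) * \<gamma>) * (norm (f0 - F))\<^sup>2 - X u) / (2 * \<beta>))) \<partial>\<pi>)\<^sup>2
    \<le> (\<integral>\<^sup>+u. (\<integral>\<^sup>+t. ennreal (exp (((norm (f0 - f t))\<^sup>2 - r t - ((norm (f0 - f u))\<^sup>2 - r u)
           - \<gamma> * (norm (f t - f u))\<^sup>2 - p u) / \<beta>)) \<partial>\<pi>) \<partial>\<pi>)"
proof -
  interpret \<pi>: prob_space \<pi> by fact
  define \<rho> where "\<rho> = gibbs \<pi> \<beta> r"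
  define Z where "Z = (\<integral>t. exp (- r t / \<beta>) \<partial>\<pi>)"
  have rm: "- m \<le> r t" if "t \<in> space \<pi>" for t using lb[OF that] by (smt (verit) zero_le_power2)
  note G = \<pi> \<open>r \<in> borel_measurable \<pi>\<close> \<beta> rm
  have Z: "0 < Z" unfolding Z_def by (rule gibbs_normalizer(2)[OF G])
  have int: "integrable \<pi> (\<lambda>t. exp (- r t / \<beta>))" by (rule gibbs_normalizer(1)[OF G])
  interpret \<rho>: prob_space \<rho> unfolding \<rho>_def by (rule prob_space_gibbs[OF G])
  have nn: "(\<integral>\<^sup>+t. g t * ennreal (exp (- r t / \<beta>)) \<partial>\<pi>) = ennreal Z * (\<integral>\<^sup>+t. g t \<partial>\<rho>)"
    if "g \<in> borel_measurable \<pi>" for g unfolding Z_def \<rho>_def by (rule nn_integral_gibbs[OF G that])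
  have sets_\<rho>[measurable_cong, simp]: "sets \<rho> = sets \<pi>" by (simp add: \<rho>_def gibbs_def)
  have space_\<rho>[simp]: "space \<rho> = space \<pi>" by (simp add: \<rho>_def gibbs_def)
  have int2y: "integrable \<rho> (\<lambda>t. (norm (f t - y))\<^sup>2)"
  proof (rule integrableI_nonneg)
    have "ennreal Z * (\<integral>\<^sup>+t. ennreal ((norm (f t - y))\<^sup>2) \<partial>\<rho>)
        = (\<integral>\<^sup>+t. ennreal ((norm (f t - y))\<^sup>2) * ennreal (exp (- r t / \<beta>)) \<partial>\<pi>)"
      by (subst nn) auto
    also have "\<dots> \<le> (\<integral>\<^sup>+t. ennreal (\<beta> * exp (m / \<beta>)) \<partial>\<pi>)"
    proof (intro nn_integral_mono)
      fix t assume t: "t \<in> space \<pi>"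
      define s where "s = (norm (f t - y))\<^sup>2"
      have sr: "s - m \<le> r t" using lb[OF t] by (simp add: s_def norm_minus_commute)
      \<comment> \<open>The weight exp(- r / \<beta>) beats the growth of the squared distance.\<close>
      have "s / \<beta> \<le> exp (s / \<beta>)" using exp_ge_add_one_self[of "s / \<beta>"] by linarith
      then have "s \<le> \<beta> * exp (s / \<beta>)" using \<beta> by (simp add: field_simps)
      then have "s * exp (- r t / \<beta>) \<le> \<beta> * exp (s / \<beta>) * exp (- r t / \<beta>)"
        by (intro mult_right_mono) auto
      also have "\<dots> = \<beta> * exp ((s - r t) / \<beta>)" by (simp add: exp_add[symmetric] diff_divide_distrib)
      also have "\<dots> \<le> \<beta> * exp (m / \<beta>)" using sr \<beta> by (intro mult_left_mono) (auto simp: divide_right_mono)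
      finally show "ennreal ((norm (f t - y))\<^sup>2) * ennreal (exp (- r t / \<beta>)) \<le> ennreal (\<beta> * exp (m / \<beta>))"
        by (subst ennreal_mult[symmetric]) (auto simp: s_def intro: ennreal_leI)
    qed
    also have "\<dots> < \<infinity>" by (simp add: \<pi>.emeasure_space_1)
    finally show "(\<integral>\<^sup>+t. ennreal ((norm (f t - y))\<^sup>2) \<partial>\<rho>) < \<infinity>"
      using Z by (auto simp: ennreal_mult_less_top)
  qed auto
  have "integrable \<rho> (\<lambda>t. norm (f t - y))"
    by (rule \<rho>.square_integrable_imp_integrable[OF _ int2y]) auto
  then have "integrable \<rho> (\<lambda>t. f t - y)" by (subst (asm) integrable_norm_iff) auto
  then have "integrable \<rho> (\<lambda>t. (f t - y) + y)" by (intro Bochner_Integration.integrable_add) auto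
  then have intf: "integrable \<rho> f" by simp
  have F: "F = (\<integral>t. f t \<partial>\<rho>)" by (simp add: F_def \<rho>_def)
  define Vr where "Vr = (\<integral>t. (norm (f t - F))\<^sup>2 \<partial>\<rho>)"
  have Vr: "0 \<le> Vr" by (simp add: Vr_def)
  have sq: "integrable \<rho> (\<lambda>t. (norm (f t - c))\<^sup>2)" "(\<integral>t. (norm (f t - c))\<^sup>2 \<partial>\<rho>) = Vr + (norm (F - c))\<^sup>2" for c
    using integral_norm_diff_sq[OF \<rho>.prob_space_axioms intf int2y, of c] by (auto simp: F Vr_def)
  define \<alpha> where "\<alpha> = 1 - (1 + \<nu>) * \<gamma>"
  define D where "D = (norm (f0 - F))\<^sup>2"
  have DF: "D = (norm (F - f0))\<^sup>2" by (simp add: D_def norm_minus_commute)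
  have \<gamma>1: "\<gamma> \<le> 1"
    using \<gamma>(2) mult_nonneg_nonneg[OF less_imp_le[OF \<nu>] \<gamma>(1)] by (simp add: algebra_simps)
  let ?g = "\<lambda>t u. (norm (f0 - f t))\<^sup>2 - r t - ((norm (f0 - f u))\<^sup>2 - r u) - \<gamma> * (norm (f t - f u))\<^sup>2 - p u"
  have inner: "ennreal Z * ennreal (exp ((\<alpha> * D - X u + r u) / \<beta>)) \<le> (\<integral>\<^sup>+t. ennreal (exp (?g t u / \<beta>)) \<partial>\<pi>)" for u
  proof -
    let ?h = "\<lambda>t. ((norm (f t - f0))\<^sup>2 - \<gamma> * (norm (f t - f u))\<^sup>2 + (r u - (norm (f0 - f u))\<^sup>2 - p u)) / \<beta>"
    have hint: "integrable \<rho> ?h" using sq(1) by auto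
    have hval: "(\<integral>t. ?h t \<partial>\<rho>) = ((Vr + D) - \<gamma> * (Vr + (norm (F - f u))\<^sup>2) + (r u - (norm (f0 - f u))\<^sup>2 - p u)) / \<beta>"
      using sq \<rho>.prob_space by (simp add: DF)
    have young: "(norm (F - f u))\<^sup>2 \<le> (1 + \<nu>) * D + (1 + \<nu>) / \<nu> * (norm (f0 - f u))\<^sup>2"
    proof -
      define a b where "a = F - f0" and "b = f0 - f u"
      have ab: "F - f u = a + b" by (simp add: a_def b_def)
      have "0 \<le> (norm (\<nu> *\<^sub>R a - b))\<^sup>2" by simp
      also have "\<dots> = \<nu>\<^sup>2 * (norm a)\<^sup>2 - 2 * \<nu> * (a \<bullet> b) + (norm b)\<^sup>2"
        unfolding power2_norm_eq_inner by (simp add: algebra_simps inner_commute power2_eq_square)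
      finally have "2 * (a \<bullet> b) \<le> \<nu> * (norm a)\<^sup>2 + (norm b)\<^sup>2 / \<nu>"
        using \<nu> by (simp add: field_simps power2_eq_square)
      moreover have "(norm (a + b))\<^sup>2 = (norm a)\<^sup>2 + 2 * (a \<bullet> b) + (norm b)\<^sup>2"
        unfolding power2_norm_eq_inner by (simp add: algebra_simps inner_commute)
      moreover have "D = (norm a)\<^sup>2" by (simp add: D_def a_def norm_minus_commute)
      moreover have "(1 + \<nu>) / \<nu> = 1 + 1 / \<nu>" using \<nu> by (simp add: field_simps)
      ultimately show ?thesis unfolding ab b_def[symmetric] by (simp add: algebra_simps)
    qed
    have "\<gamma> * (norm (F - f u))\<^sup>2 \<le> \<gamma> * ((1 + \<nu>) * D + (1 + \<nu>) / \<nu> * (norm (f0 - f u))\<^sup>2)"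
      by (intro mult_left_mono young \<gamma>)
    moreover have "\<gamma> * Vr \<le> Vr" using \<gamma>1 Vr by (simp add: mult_left_le_one_le \<gamma>(1))
    ultimately have le: "\<alpha> * D - X u + r u \<le> (Vr + D) - \<gamma> * (Vr + (norm (F - f u))\<^sup>2) + (r u - (norm (f0 - f u))\<^sup>2 - p u)"
      unfolding \<alpha>_def X_def by (simp add: algebra_simps)
    have "ennreal (exp ((\<alpha> * D - X u + r u) / \<beta>)) \<le> ennreal (exp (\<integral>t. ?h t \<partial>\<rho>))"
      unfolding hval using le \<beta> by (intro ennreal_leI) (simp add: divide_right_mono)
    also have "\<dots> \<le> (\<integral>\<^sup>+t. ennreal (exp (?h t)) \<partial>\<rho>)"
      by (rule exp_integral_le_nn_integral_exp[OF \<rho>.prob_space_axioms hint])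
    finally have "ennreal Z * ennreal (exp ((\<alpha> * D - X u + r u) / \<beta>)) \<le> ennreal Z * (\<integral>\<^sup>+t. ennreal (exp (?h t)) \<partial>\<rho>)"
      by (rule mult_left_mono) simp
    also have "\<dots> = (\<integral>\<^sup>+t. ennreal (exp (?h t)) * ennreal (exp (- r t / \<beta>)) \<partial>\<pi>)"
      by (subst nn) auto
    also have "\<dots> = (\<integral>\<^sup>+t. ennreal (exp (?g t u / \<beta>)) \<partial>\<pi>)"
      by (intro nn_integral_cong)
        (simp add: ennreal_mult[symmetric] exp_add[symmetric] add_divide_distrib[symmetric]
          diff_divide_distrib[symmetric] norm_minus_commute algebra_simps)
    finally show ?thesis .
  qed
  have sq_exp: "(ennreal (exp (z / (2 * \<beta>))))\<^sup>2 = ennreal (exp (z / \<beta>))" for z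
    by (simp add: ennreal_power exp_double[symmetric])
  have [measurable]: "X \<in> borel_measurable \<pi>" unfolding X_def by measurable
  have "(\<integral>\<^sup>+u. ennreal (exp ((\<alpha> * D - X u) / (2 * \<beta>))) \<partial>\<pi>)\<^sup>2
      = (\<integral>\<^sup>+u. ennreal (exp (- r u / (2 * \<beta>))) * ennreal (exp ((\<alpha> * D - X u + r u) / (2 * \<beta>))) \<partial>\<pi>)\<^sup>2"
    by (intro arg_cong[where f = "\<lambda>x. x\<^sup>2"] nn_integral_cong)
      (simp add: ennreal_mult[symmetric] exp_add[symmetric] add_divide_distrib diff_divide_distrib)
  also have "\<dots> \<le> (\<integral>\<^sup>+u. (ennreal (exp (- r u / (2 * \<beta>))))\<^sup>2 \<partial>\<pi>) *
      (\<integral>\<^sup>+u. (ennreal (exp ((\<alpha> * D - X u + r u) / (2 * \<beta>))))\<^sup>2 \<partial>\<pi>)"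
    by (intro Cauchy_Schwarz_nn_integral) auto
  also have "(\<lambda>u. (ennreal (exp (- r u / (2 * \<beta>))))\<^sup>2) = (\<lambda>u. ennreal (exp (- r u / \<beta>)))"
    by (simp only: sq_exp)
  also have "(\<integral>\<^sup>+u. ennreal (exp (- r u / \<beta>)) \<partial>\<pi>) = ennreal Z"
    unfolding Z_def using int by (intro nn_integral_eq_integral) auto
  also have "(\<lambda>u. (ennreal (exp ((\<alpha> * D - X u + r u) / (2 * \<beta>))))\<^sup>2) = (\<lambda>u. ennreal (exp ((\<alpha> * D - X u + r u) / \<beta>)))"
    by (simp only: sq_exp)
  also have "ennreal Z * (\<integral>\<^sup>+u. ennreal (exp ((\<alpha> * D - X u + r u) / \<beta>)) \<partial>\<pi>)
      = (\<integral>\<^sup>+u. ennreal Z * ennreal (exp ((\<alpha> * D - X u + r u) / \<beta>)) \<partial>\<pi>)"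
    by (rule nn_integral_cmult[symmetric]) measurable
  also have "\<dots> \<le> (\<integral>\<^sup>+u. (\<integral>\<^sup>+t. ennreal (exp (?g t u / \<beta>)) \<partial>\<pi>) \<partial>\<pi>)"
    by (intro nn_integral_mono inner)
  finally show ?thesis unfolding \<alpha>_def D_def .
qed

section \<open>The moment of a pair of estimators\<close>

text \<open>The least constant exists: the admissible constants form a closed set that is bounded below and
contains norm v, because the squared Frobenius norm Tr(A^2) dominates the squared operator norm.\<close>

lemma tilde_norm_bound:
  fixes A :: "'t \<Rightarrow> real^'n^'n"
  assumes "\<And>t. t \<in> space T \<Longrightarrow> sym_psd (A t)" and "t \<in> space T"
  shows "(norm (A t *v v))\<^sup>2 \<le> (tilde_norm T A v)\<^sup>2 * trace (A t ** A t)"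
proof -
  define S where "S = {0..} \<inter> (\<Inter>t\<in>space T. {C. (norm (A t *v v))\<^sup>2 \<le> C\<^sup>2 * trace (A t ** A t)})"
  have mem: "C \<in> S \<longleftrightarrow> 0 \<le> C \<and> (\<forall>t\<in>space T. (norm (A t *v v))\<^sup>2 \<le> C\<^sup>2 * trace (A t ** A t))" for C
    by (auto simp: S_def)
  have "closed S" unfolding S_def
    by (intro closed_Int closed_INT ballI closed_Collect_le continuous_intros closed_atLeast)
  moreover have "norm v \<in> S" unfolding mem
  proof (intro conjI ballI)
    fix t assume t: "t \<in> space T"
    have psd: "sym_psd (A t)" using assms(1)[OF t] .
    obtain B l where B: "orthonormal_basis B" and l: "\<And>e. e \<in> B \<Longrightarrow> A t *v e = l e *\<^sub>R e"
      and "\<And>e. e \<in> B \<Longrightarrow> 0 \<le> l e" "\<And>e. e \<in> B \<Longrightarrow> l e \<le> spectral_norm (A t)"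
      and "trace (A t) = (\<Sum>e\<in>B. l e)" and tr: "trace (A t ** A t) = (\<Sum>e\<in>B. (l e)\<^sup>2)"
      by (rule sym_psd_eigenbasis[OF psd]) (rule that)
    have "(norm (A t *v v))\<^sup>2 = (\<Sum>e\<in>B. (e \<bullet> (A t *v v)) * (e \<bullet> (A t *v v)))"
      using orthonormal_basis_parseval[OF B, of "A t *v v" "A t *v v"] by (simp only: power2_norm_eq_inner)
    also have "\<dots> = (\<Sum>e\<in>B. (l e * (e \<bullet> v))\<^sup>2)"
      by (intro sum.cong refl) (simp add: sym_psd_inner_swap[OF psd] l power2_eq_square)
    also have "\<dots> \<le> (\<Sum>e\<in>B. (norm v)\<^sup>2 * (l e)\<^sup>2)"
    proof (intro sum_mono)
      fix e assume "e \<in> B"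
      then have "\<bar>e \<bullet> v\<bar> \<le> norm v" using B Cauchy_Schwarz_ineq2[of e v] by (simp add: orthonormal_basis_def)
      then have "(e \<bullet> v)\<^sup>2 \<le> (norm v)\<^sup>2" by (metis abs_le_square_iff abs_norm_cancel)
      then show "(l e * (e \<bullet> v))\<^sup>2 \<le> (norm v)\<^sup>2 * (l e)\<^sup>2"
        by (subst mult.commute) (simp add: power_mult_distrib mult_left_mono)
    qed
    finally show "(norm (A t *v v))\<^sup>2 \<le> (norm v)\<^sup>2 * trace (A t ** A t)"
      by (simp add: tr sum_distrib_left)
  qed simp
  moreover have bdd: "bdd_below S" by (intro bdd_belowI[of _ 0]) (simp add: mem)
  ultimately have "Inf S \<in> S" by (intro closed_contains_Inf) auto
  moreover have "tilde_norm T A v = Inf S"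
    unfolding tilde_norm_def mem[symmetric]
    by (rule Least_equality) (use \<open>Inf S \<in> S\<close> bdd in \<open>auto intro: cInf_lower\<close>)
  ultimately show ?thesis using assms(2) by (simp add: mem)
qed

text \<open>With p and q the two square roots in the definition, (p - q)(p + q) = 16 \<open>\<sigma>\<close>^2 V \<open>\<delta>\<close> and
2 \<open>\<gamma>\<close> V = (p - q) / (p + q), from which both claims are immediate. The equation says that the
fraction \<open>\<delta>\<close> of the bound 2 \<open>\<sigma>\<close>^2 (1 + 2 \<open>\<gamma>\<close> V)^2 |m|^2 / (\<open>\<beta>\<close> - 4 \<open>\<sigma>\<close>^2 V) on the linear part is exactly
\<open>\<gamma>\<close> |m|^2.\<close>

lemma ewa_gamma_root:
  fixes \<beta> \<sigma> V \<delta> :: real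
  assumes "0 < \<sigma>" "0 < V" "0 \<le> \<delta>" "\<beta> \<ge> 4 * \<sigma>\<^sup>2 * V * (1 + 4 * \<delta>)" "\<beta> > 4 * \<sigma>\<^sup>2 * V"
  defines "\<gamma> \<equiv> ewa_gamma \<beta> \<sigma> V \<delta>"
  shows "0 \<le> \<gamma>" and "2 * \<sigma>\<^sup>2 * \<delta> * (1 + 2 * \<gamma> * V)\<^sup>2 = \<gamma> * (\<beta> - 4 * \<sigma>\<^sup>2 * V)"
proof -
  have "0 \<le> \<gamma> \<and> 2 * \<sigma>\<^sup>2 * \<delta> * (1 + 2 * \<gamma> * V)\<^sup>2 = \<gamma> * (\<beta> - 4 * \<sigma>\<^sup>2 * V)"
  proof (cases "\<delta> = 0")
    case True
    then show ?thesis by (simp add: \<gamma>_def ewa_gamma_def)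
  next
    case False
    then have \<delta>: "\<delta> > 0" using assms by simp
    define p q where "p = sqrt (\<beta> - 4 * \<sigma>\<^sup>2 * V)" and "q = sqrt (\<beta> - 4 * \<sigma>\<^sup>2 * V * (1 + 4 * \<delta>))"
    have p: "p > 0" "p\<^sup>2 = \<beta> - 4 * \<sigma>\<^sup>2 * V" and q: "q \<ge> 0" "q\<^sup>2 = \<beta> - 4 * \<sigma>\<^sup>2 * V * (1 + 4 * \<delta>)"
      using assms by (auto simp: p_def q_def)
    have pq: "(p - q) * (p + q) = 16 * \<sigma>\<^sup>2 * V * \<delta>"
      using p(2) q(2) by (simp add: algebra_simps power2_eq_square)
    have s: "p + q > 0" using p q by simp
    have pos: "16 * \<sigma>\<^sup>2 * V * \<delta> > 0" using assms \<delta> by simp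
    have "\<beta> - 4 * \<sigma>\<^sup>2 * V * (1 + 2 * \<delta>) = (p\<^sup>2 + q\<^sup>2) / 2" using p(2) q(2) by (simp add: algebra_simps)
    moreover have "\<gamma> = (\<beta> - 4 * \<sigma>\<^sup>2 * V * (1 + 2 * \<delta>) - p * q) / (16 * \<sigma>\<^sup>2 * \<delta> * V\<^sup>2)"
      using False by (simp add: \<gamma>_def ewa_gamma_def p_def q_def)
    moreover have "(p\<^sup>2 + q\<^sup>2) / 2 - p * q = (p - q)\<^sup>2 / 2"
      by (simp add: power2_eq_square algebra_simps)
    moreover have "16 * \<sigma>\<^sup>2 * \<delta> * V\<^sup>2 = 16 * \<sigma>\<^sup>2 * V * \<delta> * V"
      by (simp add: power2_eq_square)
    ultimately have "\<gamma> = ((p - q)\<^sup>2 / 2) / (16 * \<sigma>\<^sup>2 * V * \<delta> * V)" by (simp only:)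
    moreover have d: "p - q > 0" using pq pos s by (metis zero_less_mult_pos2)
    moreover have "z\<^sup>2 / 2 / (z * (p + q) * V) = z / (2 * V * (p + q))" if "z > 0" for z
      using that s \<open>0 < V\<close> by (simp add: power2_eq_square)
    ultimately have \<gamma>: "\<gamma> = (p - q) / (2 * V * (p + q))" by (simp only: pq[symmetric])
    have "0 \<le> \<gamma>" unfolding \<gamma> using d s \<open>0 < V\<close> by simp
    moreover have "1 + 2 * \<gamma> * V = 2 * p / (p + q)"
    proof -
      have "2 * \<gamma> * V = (p - q) / (p + q)" unfolding \<gamma> using s \<open>0 < V\<close>
        by (simp add: divide_simps) (simp add: algebra_simps)
      then show ?thesis using s by (simp add: divide_simps) (simp add: distrib_right)
    qed
    moreover have "2 * \<sigma>\<^sup>2 * \<delta> * (2 * p / (p + q))\<^sup>2 = \<gamma> * p\<^sup>2"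
    proof -
      have "2 * \<sigma>\<^sup>2 * \<delta> = (p - q) * (p + q) / (8 * V)" unfolding pq using \<open>0 < V\<close> by simp
      then have "2 * \<sigma>\<^sup>2 * \<delta> * (2 * p / (p + q))\<^sup>2 = (p - q) * (p + q) / (8 * V) * (2 * p / (p + q))\<^sup>2" by simp
      also have "\<dots> = \<gamma> * p\<^sup>2" unfolding \<gamma> using s \<open>0 < V\<close>
        by (simp add: power2_eq_square divide_simps)
      finally show ?thesis .
    qed
    ultimately show ?thesis by (simp only: p(2))
  qed
  then show "0 \<le> \<gamma>" and "2 * \<sigma>\<^sup>2 * \<delta> * (1 + 2 * \<gamma> * V)\<^sup>2 = \<gamma> * (\<beta> - 4 * \<sigma>\<^sup>2 * V)" by auto
qed

lemma norm_sum4_sq_le: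
  fixes a b c d :: "'a::real_inner"
  shows "(norm (a - b + c - d))\<^sup>2 \<le> 4 * ((norm a)\<^sup>2 + (norm b)\<^sup>2 + (norm c)\<^sup>2 + (norm d)\<^sup>2)"
proof -
  have two: "(norm (x + y))\<^sup>2 \<le> 2 * ((norm x)\<^sup>2 + (norm y)\<^sup>2)" for x y :: 'a
  proof -
    have "0 \<le> (norm (x - y))\<^sup>2" by simp
    then show ?thesis unfolding power2_norm_eq_inner by (simp add: algebra_simps inner_commute)
  qed
  show ?thesis using two[of "a - b" "c - d"] two[of a "- b"] two[of c "- d"]
    by (simp add: algebra_simps)
qed

text \<open>Expanding the square and dropping the two nonpositive quadratic terms, namely the one of A' and
- \<open>\<gamma>\<close> |(A - A') W|^2, leaves the quadratic form of A, a linear form with coefficient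
a = m - \<open>\<gamma>\<close> (A - A') m of norm at most (1 + 2 \<open>\<gamma>\<close> V) |m|, and the constant - \<open>\<gamma>\<close> |m|^2.\<close>

lemma subgaussian_pair_moment:
  fixes P :: "'w measure" and W :: "'w \<Rightarrow> real^'n" and A A' :: "real^'n^'n" and b b' v :: "real^'n"
  assumes P: "prob_space P" and W: "subgaussian_noise P \<sigma> W"
    and A: "sym_psd A" "spectral_norm A \<le> V" and A': "sym_psd A'" "spectral_norm A' \<le> V"
    and "0 < \<beta>" and \<beta>: "4 * \<sigma>\<^sup>2 * V < \<beta>"
    and \<gamma>: "0 \<le> \<gamma>" "2 * \<sigma>\<^sup>2 * \<delta> * (1 + 2 * \<gamma> * V)\<^sup>2 = \<gamma> * (\<beta> - 4 * \<sigma>\<^sup>2 * V)" and "\<delta> \<le> 1"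
    and C: "(norm (A *v v))\<^sup>2 \<le> C\<^sup>2 * trace (A ** A)" "(norm (A' *v v))\<^sup>2 \<le> C\<^sup>2 * trace (A' ** A')"
  defines "m \<equiv> A *v v - A' *v v + b - b'"
  defines "K \<equiv> 8 * \<sigma>\<^sup>2 * (1 - \<delta>) / (\<beta> - 4 * \<sigma>\<^sup>2 * V) * (1 + 2 * \<gamma> * V)\<^sup>2"
  shows "(\<integral>\<^sup>+\<omega>. ennreal (exp ((2 * (W \<omega> \<bullet> (A *v W \<omega> - A' *v W \<omega> + m))
        - \<gamma> * (norm (A *v W \<omega> - A' *v W \<omega> + m))\<^sup>2) / \<beta>)) \<partial>P)
    \<le> ennreal (exp ((2 * \<sigma>\<^sup>2 * trace A + 4 * \<sigma>\<^sup>2 / (\<beta> - 4 * \<sigma>\<^sup>2 * V) * (\<sigma>\<^sup>2 * trace (A ** A))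
        + K * (C\<^sup>2 * trace (A ** A) + (norm b)\<^sup>2) + K * (C\<^sup>2 * trace (A' ** A') + (norm b')\<^sup>2)) / \<beta>))"
proof -
  have [measurable]: "W \<in> borel_measurable P"
    using W by (auto simp: subgaussian_noise_def has_bochner_integral_iff)
  define D where "D = \<beta> - 4 * \<sigma>\<^sup>2 * V"
  have D: "D > 0" using \<beta> by (simp add: D_def)
  define a where "a = m - \<gamma> *\<^sub>R (A *v m - A' *v m)"
  have pw: "2 * (w \<bullet> (A *v w - A' *v w + m)) - \<gamma> * (norm (A *v w - A' *v w + m))\<^sup>2
      \<le> - \<gamma> * (norm m)\<^sup>2 + (2 * (w \<bullet> (A *v w)) + 2 * (a \<bullet> w))" for w
  proof -
    let ?d = "A *v w - A' *v w"
    have "0 \<le> w \<bullet> (A' *v w)" using A' by (simp add: sym_psd_def)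
    moreover have "0 \<le> \<gamma> * (norm ?d)\<^sup>2" using \<gamma> by simp
    moreover have "\<gamma> * (norm (?d + m))\<^sup>2 = \<gamma> * (norm ?d)\<^sup>2 + 2 * (\<gamma> * (?d \<bullet> m)) + \<gamma> * (norm m)\<^sup>2"
      unfolding power2_norm_eq_inner by (simp add: algebra_simps inner_commute)
    moreover have "?d \<bullet> m = w \<bullet> (A *v m - A' *v m)"
      by (simp add: inner_diff_left inner_diff_right sym_psd_inner_swap[OF A(1)] sym_psd_inner_swap[OF A'(1)])
    moreover have "a \<bullet> w = w \<bullet> m - \<gamma> * (w \<bullet> (A *v m - A' *v m))"
      unfolding inner_commute[of a w] by (simp add: a_def inner_diff_right)
    moreover have "w \<bullet> (?d + m) = w \<bullet> (A *v w) - w \<bullet> (A' *v w) + w \<bullet> m"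
      by (simp add: inner_add_right inner_diff_right)
    ultimately show ?thesis by simp
  qed
  have na: "norm a \<le> (1 + 2 * \<gamma> * V) * norm m"
  proof -
    have "norm (A *v m) \<le> V * norm m"
      by (rule order_trans[OF onorm[OF matrix_vector_mul_bounded_linear]
            mult_right_mono[OF A(2)[unfolded spectral_norm_def] norm_ge_zero]])
    moreover have "norm (A' *v m) \<le> V * norm m"
      by (rule order_trans[OF onorm[OF matrix_vector_mul_bounded_linear]
            mult_right_mono[OF A'(2)[unfolded spectral_norm_def] norm_ge_zero]])
    ultimately have "norm (A *v m - A' *v m) \<le> 2 * V * norm m"
      using norm_triangle_ineq4[of "A *v m" "A' *v m"] by simp
    then have "\<gamma> * norm (A *v m - A' *v m) \<le> \<gamma> * (2 * V * norm m)" by (rule mult_left_mono) fact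
    moreover have "norm a \<le> norm m + \<gamma> * norm (A *v m - A' *v m)"
      using norm_triangle_ineq4[of m "\<gamma> *\<^sub>R (A *v m - A' *v m)"] \<gamma>(1) by (simp add: a_def)
    ultimately show ?thesis by (simp add: algebra_simps)
  qed
  have na2: "2 * \<sigma>\<^sup>2 / D * (norm a)\<^sup>2 - \<gamma> * (norm m)\<^sup>2
      \<le> K * (C\<^sup>2 * trace (A ** A) + (norm b)\<^sup>2) + K * (C\<^sup>2 * trace (A' ** A') + (norm b')\<^sup>2)"
  proof -
    define q where "q = (1 + 2 * \<gamma> * V)\<^sup>2"
    have "2 * \<sigma>\<^sup>2 * \<delta> * q = \<gamma> * D" using \<gamma>(2) by (simp only: q_def D_def)
    then have "2 * \<sigma>\<^sup>2 * \<delta> * q / D = \<gamma>" using D by simp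
    then have \<gamma>q: "\<gamma> = 2 * \<sigma>\<^sup>2 * \<delta> / D * q" by simp
    have K_q: "K = 8 * \<sigma>\<^sup>2 * (1 - \<delta>) / D * q" by (simp only: K_def D_def q_def)
    have "(norm a)\<^sup>2 \<le> q * (norm m)\<^sup>2"
      using power_mono[OF na, of 2] by (simp add: q_def power_mult_distrib)
    then have "2 * \<sigma>\<^sup>2 / D * (norm a)\<^sup>2 \<le> 2 * \<sigma>\<^sup>2 / D * (q * (norm m)\<^sup>2)"
      using D by (intro mult_left_mono) auto
    then have "2 * \<sigma>\<^sup>2 / D * (norm a)\<^sup>2 - \<gamma> * (norm m)\<^sup>2 \<le> 2 * \<sigma>\<^sup>2 * (1 - \<delta>) / D * q * (norm m)\<^sup>2"
      unfolding \<gamma>q by (simp add: algebra_simps diff_divide_distrib)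
    also have "\<dots> \<le> 2 * \<sigma>\<^sup>2 * (1 - \<delta>) / D * q *
        (4 * ((C\<^sup>2 * trace (A ** A) + (norm b)\<^sup>2) + (C\<^sup>2 * trace (A' ** A') + (norm b')\<^sup>2)))"
      using norm_sum4_sq_le[of "A *v v" "A' *v v" b b'] C D \<open>\<delta> \<le> 1\<close>
      by (intro mult_left_mono) (auto simp: m_def q_def)
    also have "\<dots> = K * (C\<^sup>2 * trace (A ** A) + (norm b)\<^sup>2) + K * (C\<^sup>2 * trace (A' ** A') + (norm b')\<^sup>2)"
      unfolding K_q by (simp add: distrib_left)
    finally show ?thesis .
  qed
  have "(\<integral>\<^sup>+\<omega>. ennreal (exp ((2 * (W \<omega> \<bullet> (A *v W \<omega> - A' *v W \<omega> + m))
        - \<gamma> * (norm (A *v W \<omega> - A' *v W \<omega> + m))\<^sup>2) / \<beta>)) \<partial>P)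
      \<le> (\<integral>\<^sup>+\<omega>. ennreal (exp (- \<gamma> * (norm m)\<^sup>2 / \<beta>)) * ennreal (exp ((2 * (W \<omega> \<bullet> (A *v W \<omega>)) + 2 * (a \<bullet> W \<omega>)) / \<beta>)) \<partial>P)"
  proof (intro nn_integral_mono)
    fix \<omega>
    show "ennreal (exp ((2 * (W \<omega> \<bullet> (A *v W \<omega> - A' *v W \<omega> + m)) - \<gamma> * (norm (A *v W \<omega> - A' *v W \<omega> + m))\<^sup>2) / \<beta>))
      \<le> ennreal (exp (- \<gamma> * (norm m)\<^sup>2 / \<beta>)) * ennreal (exp ((2 * (W \<omega> \<bullet> (A *v W \<omega>)) + 2 * (a \<bullet> W \<omega>)) / \<beta>))"
      using divide_right_mono[OF pw[of "W \<omega>"], of \<beta>] \<open>0 < \<beta>\<close>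
      by (subst ennreal_mult[symmetric])
        (auto simp only: exp_add[symmetric] add_divide_distrib[symmetric] exp_le_cancel_iff exp_ge_zero intro!: ennreal_leI)
  qed
  also have "\<dots> = ennreal (exp (- \<gamma> * (norm m)\<^sup>2 / \<beta>)) *
      (\<integral>\<^sup>+\<omega>. ennreal (exp ((2 * (W \<omega> \<bullet> (A *v W \<omega>)) + 2 * (a \<bullet> W \<omega>)) / \<beta>)) \<partial>P)"
  proof (rule nn_integral_cmult)
    have [measurable]: "(\<lambda>\<omega>. A *v W \<omega>) \<in> borel_measurable P"
      by (rule borel_measurable_continuous_on[OF linear_continuous_on]) auto
    show "(\<lambda>\<omega>. ennreal (exp ((2 * (W \<omega> \<bullet> (A *v W \<omega>)) + 2 * (a \<bullet> W \<omega>)) / \<beta>))) \<in> borel_measurable P"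
      by measurable
  qed
  also have "\<dots> \<le> ennreal (exp (- \<gamma> * (norm m)\<^sup>2 / \<beta>)) *
      ennreal (exp ((2 * \<sigma>\<^sup>2 * trace A + 4 * \<sigma>\<^sup>2 / D * (\<sigma>\<^sup>2 * trace (A ** A)) + 2 * \<sigma>\<^sup>2 / D * (norm a)\<^sup>2) / \<beta>))"
    unfolding D_def by (intro mult_left_mono subgaussian_psd_quadratic[OF P W A]) (use \<beta> \<open>0 < \<beta>\<close> in auto)
  also have "\<dots> \<le> ennreal (exp ((2 * \<sigma>\<^sup>2 * trace A + 4 * \<sigma>\<^sup>2 / D * (\<sigma>\<^sup>2 * trace (A ** A))
        + K * (C\<^sup>2 * trace (A ** A) + (norm b)\<^sup>2) + K * (C\<^sup>2 * trace (A' ** A') + (norm b')\<^sup>2)) / \<beta>))"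
  proof (subst ennreal_mult[symmetric], simp, simp, rule ennreal_leI)
    show "exp (- \<gamma> * (norm m)\<^sup>2 / \<beta>) * exp ((2 * \<sigma>\<^sup>2 * trace A + 4 * \<sigma>\<^sup>2 / D * (\<sigma>\<^sup>2 * trace (A ** A)) + 2 * \<sigma>\<^sup>2 / D * (norm a)\<^sup>2) / \<beta>)
      \<le> exp ((2 * \<sigma>\<^sup>2 * trace A + 4 * \<sigma>\<^sup>2 / D * (\<sigma>\<^sup>2 * trace (A ** A))
        + K * (C\<^sup>2 * trace (A ** A) + (norm b)\<^sup>2) + K * (C\<^sup>2 * trace (A' ** A') + (norm b')\<^sup>2)) / \<beta>)"
      unfolding exp_add[symmetric] add_divide_distrib[symmetric] exp_le_cancel_iff
      using na2 \<open>0 < \<beta>\<close> by (intro divide_right_mono) linarith+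
  qed
  finally show ?thesis unfolding D_def .
qed

section \<open>Measurability of affine estimators\<close>

lemma borel_measurable_matrix_vector_mult [measurable (raw)]:
  fixes f :: "'a \<Rightarrow> real^'n^'m" and g :: "'a \<Rightarrow> real^'n"
  assumes "f \<in> borel_measurable M" "g \<in> borel_measurable M"
  shows "(\<lambda>x. f x *v g x) \<in> borel_measurable M"
  using assms
  by (rule borel_measurable_continuous_Pair)
    (simp add: matrix_vector_mult_def, intro continuous_intros)

lemma borel_measurable_trace [measurable (raw)]:
  fixes f :: "'a \<Rightarrow> real^'n^'n"
  assumes "f \<in> borel_measurable M"
  shows "(\<lambda>x. trace (f x)) \<in> borel_measurable M"
proof -
  have "continuous_on UNIV (trace :: real^'n^'n \<Rightarrow> real)"
    unfolding trace_def by (intro continuous_intros)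
  then show ?thesis using assms borel_measurable_continuous_on by blast
qed

lemma borel_measurable_trace_square [measurable (raw)]:
  fixes f :: "'a \<Rightarrow> real^'n^'n"
  assumes "f \<in> borel_measurable M"
  shows "(\<lambda>x. trace (f x ** f x)) \<in> borel_measurable M"
proof -
  have "continuous_on UNIV (\<lambda>A :: real^'n^'n. trace (A ** A))"
    unfolding trace_def matrix_matrix_mult_def by (simp, intro continuous_intros)
  then show ?thesis using assms borel_measurable_continuous_on by blast
qed

section \<open>The aggregate of affine estimators\<close>

text \<open>This is ln \<open>\<phi>\<close> \<open>\<le>\<close> \<open>\<phi>\<close> - 1, arranged so that it makes sense for an extended nonnegative \<open>\<phi>\<close>.\<close>

lemma exp_le_imp_scaled_le:
  fixes \<phi> :: ennreal
  assumes "ennreal (exp (z / \<beta>)) \<le> \<phi>" and "0 < \<beta>"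
  shows "ennreal (\<beta> + z) \<le> ennreal \<beta> * \<phi>"
proof -
  have "1 + z / \<beta> \<le> exp (z / \<beta>)" by (rule exp_ge_add_one_self)
  then have "\<beta> + z \<le> \<beta> * exp (z / \<beta>)" using \<open>0 < \<beta>\<close> by (simp add: field_simps)
  then have "ennreal (\<beta> + z) \<le> ennreal \<beta> * ennreal (exp (z / \<beta>))"
    using \<open>0 < \<beta>\<close> by (simp add: ennreal_mult[symmetric] ennreal_leI)
  also have "\<dots> \<le> ennreal \<beta> * \<phi>" using assms(1) by (rule mult_left_mono) simp
  finally show ?thesis .
qed

locale affine_ewa = prob_space P for P :: "'w measure" +
  fixes W :: "'w \<Rightarrow> real^'n" and f0 b :: "real^'n" and \<sigma> :: real
    and T :: "'t measure" and A :: "'t \<Rightarrow> real^'n^'n" and bt :: "'t \<Rightarrow> real^'n"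
    and pen :: "'t \<Rightarrow> real" and \<pi> :: "'t measure" and \<beta> V \<delta> \<gamma> C :: real
  assumes \<sigma>_pos: "0 < \<sigma>" and noise: "subgaussian_noise P \<sigma> W"
    and A_meas[measurable]: "A \<in> borel_measurable T"
    and bt_meas[measurable]: "bt \<in> borel_measurable T"
    and pen_meas[measurable]: "pen \<in> borel_measurable T"
    and A_psd: "\<And>t. t \<in> space T \<Longrightarrow> sym_psd (A t)"
    and prior: "\<pi> \<in> space (prob_algebra T)"
    and \<beta>_pos: "0 < \<beta>" and V_pos: "0 < V"
    and A_le: "\<And>t. t \<in> space T \<Longrightarrow> spectral_norm (A t) \<le> V"
    and \<delta>_ge: "0 \<le> \<delta>" and \<delta>_le: "\<delta> \<le> 1"
    and \<beta>_ge: "\<beta> \<ge> 4 * \<sigma>\<^sup>2 * V * (1 + 4 * \<delta>)" and \<beta>_gt: "\<beta> > 4 * \<sigma>\<^sup>2 * V"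
    and \<gamma>_eq: "\<gamma> = ewa_gamma \<beta> \<sigma> V \<delta>" and C_eq: "C = tilde_norm T A (f0 - b)"
    and pen_ge: "\<And>t. t \<in> space T \<Longrightarrow>
           pen t \<ge> 4 * \<sigma>\<^sup>2 / (\<beta> - 4 * \<sigma>\<^sup>2 * V) *
             (\<sigma>\<^sup>2 * trace (A t ** A t)
              + 2 * (1 - \<delta>) * (1 + 2 * \<gamma> * V)\<^sup>2
                  * (C\<^sup>2 * trace (A t ** A t) + (norm (bt t))\<^sup>2))"
begin

abbreviation est :: "real^'n \<Rightarrow> 't \<Rightarrow> real^'n" where "est \<equiv> fhat A bt b"
abbreviation risk :: "real^'n \<Rightarrow> 't \<Rightarrow> real" where "risk \<equiv> pen_risk_est \<sigma> A bt b pen"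
abbreviation cost :: "'t \<Rightarrow> real" where "cost \<equiv> price \<beta> \<sigma> V \<delta> A bt pen C"
abbreviation agg :: "real^'n \<Rightarrow> real^'n" where "agg \<equiv> f_EWA \<pi> \<beta> \<sigma> A bt b pen"

text \<open>This is the noise term g of the introduction, in a form that does not mention W and which the
deterministic bound on Gibbs aggregates applies to; lemma \<open>excess_eq\<close> brings back the noise.\<close>

definition excess :: "real^'n \<Rightarrow> 't \<Rightarrow> 't \<Rightarrow> real" where
  "excess y t u = (norm (f0 - est y t))\<^sup>2 - risk y t - ((norm (f0 - est y u))\<^sup>2 - risk y u)
     - \<gamma> * (norm (est y t - est y u))\<^sup>2 - cost u"

definition pac_moment :: "real^'n \<Rightarrow> ennreal" where
  "pac_moment y = (\<integral>\<^sup>+u. (\<integral>\<^sup>+t. ennreal (exp (excess y t u / \<beta>)) \<partial>\<pi>) \<partial>\<pi>)"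

lemma W_meas[measurable]: "W \<in> borel_measurable P"
  using noise by (auto simp: subgaussian_noise_def has_bochner_integral_iff)

lemma prob_\<pi>: "prob_space \<pi>" and sets_\<pi>[measurable_cong]: "sets \<pi> = sets T"
  using prior by (auto simp: space_prob_algebra)

lemma space_\<pi>[simp]: "space \<pi> = space T"
  by (rule sets_eq_imp_space_eq[OF sets_\<pi>])

lemma gap_pos: "0 < \<beta> - 4 * \<sigma>\<^sup>2 * V"
  using \<beta>_gt by simp

lemma \<gamma>_ge: "0 \<le> \<gamma>"
  and \<gamma>_root: "2 * \<sigma>\<^sup>2 * \<delta> * (1 + 2 * \<gamma> * V)\<^sup>2 = \<gamma> * (\<beta> - 4 * \<sigma>\<^sup>2 * V)"
  using ewa_gamma_root[OF \<sigma>_pos V_pos \<delta>_ge \<beta>_ge \<beta>_gt] by (simp_all add: \<gamma>_eq)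

lemma trace_nonneg:
  assumes "t \<in> space T" shows "0 \<le> trace (A t)" and "0 \<le> trace (A t ** A t)"
proof -
  obtain B l where "orthonormal_basis B" "\<And>e. e \<in> B \<Longrightarrow> A t *v e = l e *\<^sub>R e"
    and l: "\<And>e. e \<in> B \<Longrightarrow> 0 \<le> l e" and "\<And>e. e \<in> B \<Longrightarrow> l e \<le> spectral_norm (A t)"
    and tr: "trace (A t) = (\<Sum>e\<in>B. l e)" "trace (A t ** A t) = (\<Sum>e\<in>B. (l e)\<^sup>2)"
    by (rule sym_psd_eigenbasis[OF A_psd[OF assms]]) (rule that)
  show "0 \<le> trace (A t)" and "0 \<le> trace (A t ** A t)"
    using l by (auto simp: tr intro!: sum_nonneg)
qed

lemma pen_nonneg:
  assumes "t \<in> space T" shows "0 \<le> pen t"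
proof -
  have "0 \<le> 4 * \<sigma>\<^sup>2 / (\<beta> - 4 * \<sigma>\<^sup>2 * V) * (\<sigma>\<^sup>2 * trace (A t ** A t)
      + 2 * (1 - \<delta>) * (1 + 2 * \<gamma> * V)\<^sup>2 * (C\<^sup>2 * trace (A t ** A t) + (norm (bt t))\<^sup>2))"
    using gap_pos \<delta>_le trace_nonneg[OF assms]
    by (intro mult_nonneg_nonneg add_nonneg_nonneg divide_nonneg_pos) auto
  then show ?thesis using pen_ge[OF assms] by linarith
qed

lemma cost_nonneg:
  assumes "t \<in> space T" shows "0 \<le> cost t"
  unfolding price_def \<gamma>_eq[symmetric]
  using gap_pos \<delta>_le trace_nonneg[OF assms] pen_nonneg[OF assms]
  by (intro mult_nonneg_nonneg add_nonneg_nonneg divide_nonneg_pos) auto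

lemma measurable_est [measurable (raw)]:
  assumes [measurable]: "g \<in> borel_measurable M" "h \<in> measurable M T"
  shows "(\<lambda>x. est (g x) (h x)) \<in> borel_measurable M"
  unfolding fhat_def by measurable

lemma measurable_risk [measurable (raw)]:
  assumes [measurable]: "g \<in> borel_measurable M" "h \<in> measurable M T"
  shows "(\<lambda>x. risk (g x) (h x)) \<in> borel_measurable M"
  unfolding pen_risk_est_def risk_est_def by measurable

lemma measurable_cost [measurable (raw)]:
  assumes [measurable]: "h \<in> measurable M T"
  shows "(\<lambda>x. cost (h x)) \<in> borel_measurable M"
  unfolding price_def by measurable

lemma measurable_excess [measurable (raw)]:
  assumes [measurable]: "g \<in> borel_measurable M" "h \<in> measurable M T" "k \<in> measurable M T"
  shows "(\<lambda>x. excess (g x) (h x) (k x)) \<in> borel_measurable M"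
  unfolding excess_def by measurable

text \<open>The contributions |W|^2, n \<open>\<sigma>\<close>^2 and 2 W . \<open>f\<^sub>0\<close> to the risk estimates do not depend on the index and
cancel between t and u.\<close>

lemma excess_eq:
  fixes w :: "real^'n" and t u :: 't
  defines "m \<equiv> A t *v (f0 - b) - A u *v (f0 - b) + bt t - bt u"
  shows "excess (f0 + w) t u = 2 * (w \<bullet> (A t *v w - A u *v w + m)) - \<gamma> * (norm (A t *v w - A u *v w + m))\<^sup>2
    - 2 * \<sigma>\<^sup>2 * trace (A t) - pen t - (cost u - pen u - 2 * \<sigma>\<^sup>2 * trace (A u))"
proof -
  have diff: "est (f0 + w) t - est (f0 + w) u = A t *v w - A u *v w + m"
    by (simp add: fhat_def m_def matrix_vector_right_distrib matrix_vector_mult_diff_distrib algebra_simps)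
  have pt: "(norm (f0 - est (f0 + w) s))\<^sup>2 - risk (f0 + w) s
      = 2 * (w \<bullet> est (f0 + w) s) - 2 * \<sigma>\<^sup>2 * trace (A s) - pen s
        + (real CARD('n) * \<sigma>\<^sup>2 - w \<bullet> w - 2 * (w \<bullet> f0))" for s
    unfolding pen_risk_est_def risk_est_def power2_norm_eq_inner
    by (simp add: algebra_simps inner_commute)
  show ?thesis
    unfolding excess_def pt diff[symmetric] by (simp add: inner_diff_right)
qed

text \<open>Of the terms of the pair moment that belong to t, the trace of \<open>A\<^sub>t\<close> is cancelled by the bias
correction in the risk estimate and all others by the lower bound on pen(t); those that belong to u
are cancelled by the last summand of price(u).\<close>

lemma expectation_excess:
  assumes t: "t \<in> space T" and u: "u \<in> space T"
  shows "(\<integral>\<^sup>+\<omega>. ennreal (exp (excess (f0 + W \<omega>) t u / \<beta>)) \<partial>P) \<le> 1"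
proof -
  define m where "m = A t *v (f0 - b) - A u *v (f0 - b) + bt t - bt u"
  define K where "K = 8 * \<sigma>\<^sup>2 * (1 - \<delta>) / (\<beta> - 4 * \<sigma>\<^sup>2 * V) * (1 + 2 * \<gamma> * V)\<^sup>2"
  define q where "q = (\<lambda>s. K * (C\<^sup>2 * trace (A s ** A s) + (norm (bt s))\<^sup>2))"
  define c where "c = - 2 * \<sigma>\<^sup>2 * trace (A t) - pen t - q u"
  define B where "B = 2 * \<sigma>\<^sup>2 * trace (A t) + 4 * \<sigma>\<^sup>2 / (\<beta> - 4 * \<sigma>\<^sup>2 * V) * (\<sigma>\<^sup>2 * trace (A t ** A t)) + q t + q u"
  let ?d = "\<lambda>w. A t *v w - A u *v w + m"
  have cost: "cost u - pen u - 2 * \<sigma>\<^sup>2 * trace (A u) = q u"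
    by (simp add: price_def q_def K_def \<gamma>_eq)
  have "B + c \<le> 0"
    using pen_ge[OF t] unfolding B_def c_def q_def K_def
    by (simp add: algebra_simps add_divide_distrib diff_divide_distrib)
  have "(\<integral>\<^sup>+\<omega>. ennreal (exp (excess (f0 + W \<omega>) t u / \<beta>)) \<partial>P)
      = (\<integral>\<^sup>+\<omega>. ennreal (exp (c / \<beta>)) * ennreal (exp ((2 * (W \<omega> \<bullet> ?d (W \<omega>)) - \<gamma> * (norm (?d (W \<omega>)))\<^sup>2) / \<beta>)) \<partial>P)"
    by (intro nn_integral_cong)
      (simp add: excess_eq m_def[symmetric] cost c_def ennreal_mult[symmetric] exp_add[symmetric]
        add_divide_distrib[symmetric])
  also have "\<dots> = ennreal (exp (c / \<beta>)) * (\<integral>\<^sup>+\<omega>. ennreal (exp ((2 * (W \<omega> \<bullet> ?d (W \<omega>)) - \<gamma> * (norm (?d (W \<omega>)))\<^sup>2) / \<beta>)) \<partial>P)"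
    by (rule nn_integral_cmult) measurable
  also have "\<dots> \<le> ennreal (exp (c / \<beta>)) * ennreal (exp (B / \<beta>))"
    unfolding B_def q_def K_def m_def
    by (intro mult_left_mono subgaussian_pair_moment[OF prob_space_axioms noise])
      (use t u A_psd A_le \<beta>_pos \<beta>_gt \<gamma>_ge \<gamma>_root \<delta>_le tilde_norm_bound[OF A_psd] in \<open>auto simp: C_eq\<close>)
  also have "\<dots> = ennreal (exp ((B + c) / \<beta>))"
    by (simp add: ennreal_mult[symmetric] exp_add[symmetric] add_divide_distrib add.commute)
  also have "\<dots> \<le> 1"
    using \<open>B + c \<le> 0\<close> \<beta>_pos by (simp add: divide_nonpos_pos)
  finally show ?thesis .
qed

lemma measurable_pac_moment: "(\<lambda>\<omega>. pac_moment (f0 + W \<omega>)) \<in> borel_measurable P"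
proof -
  interpret \<pi>: prob_space \<pi> by (rule prob_\<pi>)
  show ?thesis unfolding pac_moment_def by measurable
qed

lemma expectation_pac_moment: "(\<integral>\<^sup>+\<omega>. pac_moment (f0 + W \<omega>) \<partial>P) \<le> 1"
proof -
  interpret \<pi>: prob_space \<pi> by (rule prob_\<pi>)
  interpret \<pi>P: pair_sigma_finite \<pi> P by unfold_locales
  let ?h = "\<lambda>u t \<omega>. ennreal (exp (excess (f0 + W \<omega>) t u / \<beta>))"
  have "(\<integral>\<^sup>+\<omega>. pac_moment (f0 + W \<omega>) \<partial>P) = (\<integral>\<^sup>+u. (\<integral>\<^sup>+\<omega>. (\<integral>\<^sup>+t. ?h u t \<omega> \<partial>\<pi>) \<partial>P) \<partial>\<pi>)"
    unfolding pac_moment_def by (rule \<pi>P.Fubini') measurable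
  also have "\<dots> = (\<integral>\<^sup>+u. (\<integral>\<^sup>+t. (\<integral>\<^sup>+\<omega>. ?h u t \<omega> \<partial>P) \<partial>\<pi>) \<partial>\<pi>)"
    by (intro nn_integral_cong \<pi>P.Fubini') measurable
  also have "\<dots> \<le> (\<integral>\<^sup>+u. (\<integral>\<^sup>+t. 1 \<partial>\<pi>) \<partial>\<pi>)"
    by (intro nn_integral_mono expectation_excess) auto
  also have "\<dots> = 1" using \<pi>.emeasure_space_1 by simp
  finally show ?thesis .
qed

text \<open>Integrating against the Gibbs density turns the aggregate into a prior integral of a jointly
measurable function.\<close>

lemma measurable_agg: "(\<lambda>\<omega>. agg (f0 + W \<omega>)) \<in> borel_measurable P"
proof -
  interpret \<pi>: prob_space \<pi> by (rule prob_\<pi>)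
  have eq: "agg y = (\<integral>t. (exp (- risk y t / \<beta>) / (\<integral>s. exp (- risk y s / \<beta>) \<partial>\<pi>)) *\<^sub>R est y t \<partial>\<pi>)" for y
    unfolding f_EWA_def gibbs_def
    by (rule integral_density) (auto intro!: integral_nonneg_AE divide_nonneg_nonneg)
  show ?thesis unfolding eq by measurable
qed

lemma risk_lower_bound:
  assumes "t \<in> space T"
  shows "(norm (y - est y t))\<^sup>2 - real CARD('n) * \<sigma>\<^sup>2 \<le> risk y t"
  using trace_nonneg[OF assms] pen_nonneg[OF assms] by (simp add: pen_risk_est_def risk_est_def)

text \<open>What the aggregate is compared with at the index u, before the division by 1 - (1 + \<open>\<nu>\<close>) \<open>\<gamma>\<close> that
produces the constants 1 + eps and 1 + eps'.\<close>

definition comparison :: "real \<Rightarrow> real^'n \<Rightarrow> 't \<Rightarrow> real" where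
  "comparison \<nu> y u = (1 + (1 + \<nu>) / \<nu> * \<gamma>) * (norm (f0 - est y u))\<^sup>2 + cost u"

text \<open>The prior in the deterministic bound is replaced by \<open>\<mu>\<close>. The Donsker-Varadhan inequality is applied
under the square, which doubles the divergence.\<close>

lemma pointwise_oracle:
  assumes \<nu>: "\<nu> \<in> nu_set \<gamma>" and \<mu>: "\<mu> \<in> space (prob_algebra T)"
    and X: "(\<integral>\<^sup>+u. ennreal (comparison \<nu> y u) \<partial>\<mu>) \<noteq> \<infinity>" and KL: "KL \<mu> \<pi> \<noteq> \<infinity>"
  shows "ennreal (exp (((1 - (1 + \<nu>) * \<gamma>) * (norm (f0 - agg y))\<^sup>2
      - enn2real (\<integral>\<^sup>+u. ennreal (comparison \<nu> y u) \<partial>\<mu>) - 2 * \<beta> * enn2real (KL \<mu> \<pi>)) / \<beta>)) \<le> pac_moment y"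
proof -
  have sets_\<mu>[measurable_cong]: "sets \<mu> = sets T" and p\<mu>: "prob_space \<mu>"
    using \<mu> by (auto simp: space_prob_algebra)
  have space_\<mu>: "space \<mu> = space T" by (rule sets_eq_imp_space_eq[OF sets_\<mu>])
  have \<nu>': "0 < \<nu>" "(1 + \<nu>) * \<gamma> < 1" using \<nu> by (auto simp: nu_set_def)
  define aD where "aD = (1 - (1 + \<nu>) * \<gamma>) * (norm (f0 - agg y))\<^sup>2"
  define Xc where "Xc = comparison \<nu> y"
  define I where "I = (\<integral>u. Xc u \<partial>\<mu>)"
  define k where "k = enn2real (KL \<mu> \<pi>)"
  have [measurable]: "Xc \<in> borel_measurable T"
    unfolding Xc_def comparison_def by measurable
  have X0: "0 \<le> Xc u" if "u \<in> space T" for u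
    unfolding Xc_def comparison_def using cost_nonneg[OF that] \<nu>' \<gamma>_ge
    by (intro add_nonneg_nonneg mult_nonneg_nonneg) auto
  have int: "integrable \<mu> Xc"
    using X[folded Xc_def] X0
    by (intro integrableI_nonneg) (auto simp: space_\<mu> top.not_eq_extremum intro!: AE_I2)
  have I: "enn2real (\<integral>\<^sup>+u. ennreal (comparison \<nu> y u) \<partial>\<mu>) = I"
  proof -
    have "0 \<le> I" unfolding I_def using X0 by (intro integral_nonneg_AE AE_I2) (simp add: space_\<mu>)
    moreover have "(\<integral>\<^sup>+u. ennreal (Xc u) \<partial>\<mu>) = ennreal I"
      unfolding I_def using X0 int by (intro nn_integral_eq_integral AE_I2) (auto simp: space_\<mu>)
    ultimately show ?thesis by (simp add: Xc_def)
  qed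
  have dv: "ennreal (exp (- (I / (2 * \<beta>)) - k)) \<le> (\<integral>\<^sup>+u. ennreal (exp (- (Xc u / (2 * \<beta>)))) \<partial>\<pi>)"
    using donsker_varadhan[OF prob_\<pi> p\<mu> _ _ _ KL, of "\<lambda>u. Xc u / (2 * \<beta>)"] int
    by (simp add: sets_\<mu> sets_\<pi> I_def k_def)
  have "ennreal (exp ((aD - I - 2 * \<beta> * k) / \<beta>)) = (ennreal (exp (aD / (2 * \<beta>))) * ennreal (exp (- (I / (2 * \<beta>)) - k)))\<^sup>2"
  proof -
    have "(aD - I - 2 * \<beta> * k) / \<beta> = 2 * (aD / (2 * \<beta>) + (- (I / (2 * \<beta>)) - k))"
      using \<beta>_pos by (simp add: field_simps)
    then show ?thesis
      by (simp only: ennreal_mult[symmetric] exp_ge_zero exp_double exp_add)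
        (rule ennreal_power[symmetric], simp)
  qed
  also have "\<dots> \<le> (ennreal (exp (aD / (2 * \<beta>))) * (\<integral>\<^sup>+u. ennreal (exp (- (Xc u / (2 * \<beta>)))) \<partial>\<pi>))\<^sup>2"
    by (intro power_mono mult_left_mono dv) auto
  also have "ennreal (exp (aD / (2 * \<beta>))) * (\<integral>\<^sup>+u. ennreal (exp (- (Xc u / (2 * \<beta>)))) \<partial>\<pi>)
      = (\<integral>\<^sup>+u. ennreal (exp ((aD - Xc u) / (2 * \<beta>))) \<partial>\<pi>)"
    by (subst nn_integral_cmult[symmetric])
      (auto intro!: nn_integral_cong simp: ennreal_mult[symmetric] exp_add[symmetric] diff_divide_distrib)
  also have "\<dots>\<^sup>2 \<le> pac_moment y"
    unfolding aD_def Xc_def comparison_def pac_moment_def excess_def f_EWA_def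
    by (rule gibbs_aggregate_bound[OF prob_\<pi>, where m = "real CARD('n) * \<sigma>\<^sup>2" and y = y])
      (use \<beta>_pos \<gamma>_ge \<nu>' risk_lower_bound in auto)
  finally show ?thesis unfolding I aD_def k_def .
qed

text \<open>With \<open>\<alpha>\<close> = 1 - (1 + \<open>\<nu>\<close>) \<open>\<gamma>\<close> one has 1 + eps' = 1 / \<open>\<alpha>\<close> and
1 + eps = (1 + (1 + \<open>\<nu>\<close>) \<open>\<gamma>\<close> / \<open>\<nu>\<close>) / \<open>\<alpha>\<close>.\<close>

lemma oracle_rhs_eq:
  assumes "\<nu> \<in> nu_set \<gamma>"
  shows "ennreal (1 + eps \<gamma> \<nu>) * I + ennreal (1 + eps' \<gamma> \<nu>) * J + ennreal (\<beta> * (1 + eps' \<gamma> \<nu>)) * L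
    = ennreal (1 / (1 - (1 + \<nu>) * \<gamma>)) * (ennreal (1 + (1 + \<nu>) / \<nu> * \<gamma>) * I + J + ennreal \<beta> * L)"
proof -
  define \<alpha> where "\<alpha> = 1 - (1 + \<nu>) * \<gamma>"
  have \<nu>: "0 < \<nu>" "\<alpha> > 0" using assms by (auto simp: nu_set_def \<alpha>_def)
  have g: "(1 + \<nu>) * \<gamma> = 1 - \<alpha>" by (simp add: \<alpha>_def)
  have e': "1 + eps' \<gamma> \<nu> = 1 / \<alpha>"
    unfolding eps'_def g using \<nu> by (simp add: field_simps)
  have "(1 + (1 + \<nu>) / \<nu> * \<gamma>) = 1 + (1 - \<alpha>) / \<nu>"
    using g by simp
  moreover have "1 + eps \<gamma> \<nu> = 1 + (1 + \<nu>) / \<nu> * ((1 - \<alpha>) / \<alpha>)"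
    unfolding eps_def g by simp
  moreover have "1 + (1 + \<nu>) / \<nu> * ((1 - \<alpha>) / \<alpha>) = 1 / \<alpha> * (1 + (1 - \<alpha>) / \<nu>)"
    using \<nu> by (simp add: field_simps)
  ultimately have e: "1 + eps \<gamma> \<nu> = 1 / \<alpha> * (1 + (1 + \<nu>) / \<nu> * \<gamma>)" by (simp only:)
  have pos: "0 \<le> 1 + (1 + \<nu>) / \<nu> * \<gamma>" using \<nu> \<gamma>_ge by simp
  have a: "0 \<le> 1 / \<alpha>" using \<nu> by simp
  show ?thesis
    unfolding e e' \<alpha>_def[symmetric] ennreal_mult[OF a pos] ennreal_mult[OF less_imp_le[OF \<beta>_pos] a]
    by (simp only: distrib_left mult_ac)
qed

lemma nn_integral_comparison:
  assumes \<nu>: "\<nu> \<in> nu_set \<gamma>" and \<mu>: "\<mu> \<in> space (prob_algebra T)"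
  shows "(\<integral>\<^sup>+u. ennreal (comparison \<nu> y u) \<partial>\<mu>)
    = ennreal (1 + (1 + \<nu>) / \<nu> * \<gamma>) * (\<integral>\<^sup>+u. ennreal ((norm (f0 - est y u))\<^sup>2) \<partial>\<mu>) + (\<integral>\<^sup>+u. ennreal (cost u) \<partial>\<mu>)"
proof -
  have sets_\<mu>[measurable_cong]: "sets \<mu> = sets T" using \<mu> by (auto simp: space_prob_algebra)
  have space_\<mu>: "space \<mu> = space T" by (rule sets_eq_imp_space_eq[OF sets_\<mu>])
  have pos: "0 \<le> 1 + (1 + \<nu>) / \<nu> * \<gamma>" using \<nu> \<gamma>_ge by (simp add: nu_set_def)
  have "(\<integral>\<^sup>+u. ennreal (comparison \<nu> y u) \<partial>\<mu>)
      = (\<integral>\<^sup>+u. ennreal (1 + (1 + \<nu>) / \<nu> * \<gamma>) * ennreal ((norm (f0 - est y u))\<^sup>2) + ennreal (cost u) \<partial>\<mu>)"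
    by (intro nn_integral_cong)
      (use pos cost_nonneg in \<open>simp add: comparison_def space_\<mu> ennreal_mult[symmetric]\<close>)
  also have "\<dots> = ennreal (1 + (1 + \<nu>) / \<nu> * \<gamma>) * (\<integral>\<^sup>+u. ennreal ((norm (f0 - est y u))\<^sup>2) \<partial>\<mu>) + (\<integral>\<^sup>+u. ennreal (cost u) \<partial>\<mu>)"
    by (subst nn_integral_add; (subst nn_integral_cmult)?) auto
  finally show ?thesis .
qed

lemma oracle_on_event:
  assumes \<nu>: "\<nu> \<in> nu_set \<gamma>" and \<mu>: "\<mu> \<in> space (prob_algebra T)"
    and \<eta>: "0 < \<eta>" "\<eta> \<le> 1" and event: "pac_moment y \<le> ennreal (1 / \<eta>)"
  shows "ennreal ((1 - (1 + \<nu>) * \<gamma>) * (norm (f0 - agg y))\<^sup>2)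
    \<le> (\<integral>\<^sup>+u. ennreal (comparison \<nu> y u) \<partial>\<mu>) + ennreal \<beta> * (2 * KL \<mu> \<pi> + ennreal (ln (1 / \<eta>)))"
proof (cases "(\<integral>\<^sup>+u. ennreal (comparison \<nu> y u) \<partial>\<mu>) = \<infinity> \<or> KL \<mu> \<pi> = \<infinity>")
  case True
  then show ?thesis using \<beta>_pos by (auto simp: ennreal_mult_top ennreal_mult_eq_top_iff)
next
  case False
  define x where "x = enn2real (\<integral>\<^sup>+u. ennreal (comparison \<nu> y u) \<partial>\<mu>)"
  define k where "k = enn2real (KL \<mu> \<pi>)"
  define aD where "aD = (1 - (1 + \<nu>) * \<gamma>) * (norm (f0 - agg y))\<^sup>2"
  have x: "(\<integral>\<^sup>+u. ennreal (comparison \<nu> y u) \<partial>\<mu>) = ennreal x" "0 \<le> x"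
    and k: "KL \<mu> \<pi> = ennreal k" "0 \<le> k"
    using False by (auto simp: x_def k_def top.not_eq_extremum)
  have ln: "0 \<le> ln (1 / \<eta>)" using \<eta> by simp
  have "ennreal (exp ((aD - x - 2 * \<beta> * k) / \<beta>)) \<le> ennreal (1 / \<eta>)"
    using pointwise_oracle[OF \<nu> \<mu>, of y] False event unfolding aD_def x_def k_def by (meson order_trans)
  then have "exp ((aD - x - 2 * \<beta> * k) / \<beta>) \<le> 1 / \<eta>" using \<eta> by (subst (asm) ennreal_le_iff) auto
  then have "(aD - x - 2 * \<beta> * k) / \<beta> \<le> ln (1 / \<eta>)" using \<eta> by (subst ln_ge_iff) auto
  then have "aD \<le> x + \<beta> * (2 * k + ln (1 / \<eta>))" using \<beta>_pos by (simp add: field_simps)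
  then have "ennreal aD \<le> ennreal (x + \<beta> * (2 * k + ln (1 / \<eta>)))" by (rule ennreal_leI)
  also have "\<dots> = ennreal x + ennreal \<beta> * (2 * ennreal k + ennreal (ln (1 / \<eta>)))"
    using x(2) k(2) ln \<beta>_pos by (simp add: ennreal_mult)
  finally show ?thesis by (simp only: aD_def x(1) k(1))
qed

text \<open>The summand \<open>\<beta>\<close> on the left keeps the inequality free of subtraction; in expectation it cancels against
the last term on the right.\<close>

lemma oracle_with_moment:
  assumes \<nu>: "\<nu> \<in> nu_set \<gamma>" and \<mu>: "\<mu> \<in> space (prob_algebra T)"
  shows "ennreal ((1 - (1 + \<nu>) * \<gamma>) * (norm (f0 - agg y))\<^sup>2) + ennreal \<beta>
    \<le> (\<integral>\<^sup>+u. ennreal (comparison \<nu> y u) \<partial>\<mu>) + ennreal \<beta> * (2 * KL \<mu> \<pi>) + ennreal \<beta> * pac_moment y"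
proof (cases "(\<integral>\<^sup>+u. ennreal (comparison \<nu> y u) \<partial>\<mu>) = \<infinity> \<or> KL \<mu> \<pi> = \<infinity>")
  case True
  then show ?thesis using \<beta>_pos by (auto simp: ennreal_mult_top ennreal_mult_eq_top_iff)
next
  case False
  define x where "x = enn2real (\<integral>\<^sup>+u. ennreal (comparison \<nu> y u) \<partial>\<mu>)"
  define k where "k = enn2real (KL \<mu> \<pi>)"
  define aD where "aD = (1 - (1 + \<nu>) * \<gamma>) * (norm (f0 - agg y))\<^sup>2"
  have x: "(\<integral>\<^sup>+u. ennreal (comparison \<nu> y u) \<partial>\<mu>) = ennreal x" "0 \<le> x"
    and k: "KL \<mu> \<pi> = ennreal k" "0 \<le> k"
    using False by (auto simp: x_def k_def top.not_eq_extremum)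
  have aD: "0 \<le> aD" using \<nu> by (simp add: aD_def nu_set_def)
  define z where "z = aD - x - 2 * \<beta> * k"
  have "ennreal (exp (z / \<beta>)) \<le> pac_moment y"
    using pointwise_oracle[OF \<nu> \<mu>, of y] False unfolding z_def aD_def x_def k_def by blast
  then have le: "ennreal (\<beta> + z) \<le> ennreal \<beta> * pac_moment y"
    by (rule exp_le_imp_scaled_le) (rule \<beta>_pos)
  have "ennreal aD + ennreal \<beta> = ennreal (aD + \<beta>)" using aD \<beta>_pos by simp
  also have "\<dots> \<le> ennreal ((x + \<beta> * (2 * k)) + max 0 (\<beta> + z))"
    by (intro ennreal_leI) (simp add: z_def)
  also have "\<dots> = ennreal x + ennreal \<beta> * (2 * ennreal k) + ennreal (\<beta> + z)"
    using x(2) k(2) \<beta>_pos by (simp add: ennreal_mult ennreal_max_0)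
  also have "\<dots> \<le> ennreal x + ennreal \<beta> * (2 * ennreal k) + ennreal \<beta> * pac_moment y"
    by (intro add_left_mono le)
  finally show ?thesis by (simp only: aD_def x(1) k(1))
qed

lemma scale_back:
  assumes \<nu>: "\<nu> \<in> nu_set \<gamma>"
  shows "ennreal (1 / (1 - (1 + \<nu>) * \<gamma>)) * ennreal ((1 - (1 + \<nu>) * \<gamma>) * s) = ennreal s"
  using \<nu> by (subst ennreal_mult'[symmetric]) (auto simp: nu_set_def)

text \<open>The event is that the moment variable is at most 1 / \<open>\<eta>\<close>. It depends neither on \<open>\<nu>\<close> nor on \<open>\<mu>\<close>, so
it serves the uncountable infimum without any union bound.\<close>

lemma oracle_in_probability:
  assumes \<eta>: "0 < \<eta>" "\<eta> \<le> 1"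
  shows "with_prob_at_least P (1 - \<eta>) (\<lambda>\<omega>.
    ennreal ((norm (f0 - agg (f0 + W \<omega>)))\<^sup>2)
      \<le> (INF \<nu>\<in>nu_set \<gamma>. INF \<mu>\<in>space (prob_algebra T).
            ennreal (1 + eps \<gamma> \<nu>) * (\<integral>\<^sup>+ t. ennreal ((norm (f0 - est (f0 + W \<omega>) t))\<^sup>2) \<partial>\<mu>)
          + ennreal (1 + eps' \<gamma> \<nu>) * (\<integral>\<^sup>+ t. ennreal (cost t) \<partial>\<mu>)
          + ennreal (\<beta> * (1 + eps' \<gamma> \<nu>)) * (2 * KL \<mu> \<pi> + ennreal (ln (1 / \<eta>)))))"
  unfolding with_prob_at_least_def
proof (intro bexI conjI ballI)
  note [measurable] = measurable_pac_moment
  define E where "E = {\<omega>\<in>space P. pac_moment (f0 + W \<omega>) \<le> ennreal (1 / \<eta>)}"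
  define E' where "E' = {\<omega>\<in>space P. 1 \<le> ennreal \<eta> * pac_moment (f0 + W \<omega>)}"
  have [measurable]: "E' \<in> sets P" unfolding E'_def by measurable
  show E[measurable]: "E \<in> sets P" unfolding E_def by measurable
  have "space P - E \<subseteq> E'"
  proof
    fix \<omega> assume "\<omega> \<in> space P - E"
    then have \<omega>: "\<omega> \<in> space P" "ennreal (1 / \<eta>) \<le> pac_moment (f0 + W \<omega>)" by (auto simp: E_def)
    have "1 = ennreal \<eta> * ennreal (1 / \<eta>)" using \<eta> by (simp add: ennreal_mult[symmetric])
    also have "\<dots> \<le> ennreal \<eta> * pac_moment (f0 + W \<omega>)" using \<omega>(2) by (rule mult_left_mono) simp
    finally show "\<omega> \<in> E'" using \<omega>(1) by (simp add: E'_def)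
  qed
  then have "emeasure P (space P - E) \<le> emeasure P E'" by (intro emeasure_mono) auto
  also have "\<dots> \<le> ennreal \<eta> * (\<integral>\<^sup>+\<omega>. pac_moment (f0 + W \<omega>) * indicator (space P) \<omega> \<partial>P)"
    unfolding E'_def using nn_integral_Markov_inequality[of "\<lambda>\<omega>. pac_moment (f0 + W \<omega>)" "space P" P "ennreal \<eta>"]
    by simp
  also have "(\<integral>\<^sup>+\<omega>. pac_moment (f0 + W \<omega>) * indicator (space P) \<omega> \<partial>P) = (\<integral>\<^sup>+\<omega>. pac_moment (f0 + W \<omega>) \<partial>P)"
    by (intro nn_integral_cong) simp
  also have "ennreal \<eta> * \<dots> \<le> ennreal \<eta> * 1" by (intro mult_left_mono expectation_pac_moment) simp
  finally have "prob (space P - E) \<le> \<eta>" using \<eta> by (simp add: emeasure_eq_measure)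
  then show "1 - \<eta> \<le> measure P E" by (simp add: prob_compl)
  fix \<omega> assume "\<omega> \<in> E"
  then have \<omega>: "pac_moment (f0 + W \<omega>) \<le> ennreal (1 / \<eta>)" by (simp add: E_def)
  show "ennreal ((norm (f0 - agg (f0 + W \<omega>)))\<^sup>2)
      \<le> (INF \<nu>\<in>nu_set \<gamma>. INF \<mu>\<in>space (prob_algebra T).
            ennreal (1 + eps \<gamma> \<nu>) * (\<integral>\<^sup>+ t. ennreal ((norm (f0 - est (f0 + W \<omega>) t))\<^sup>2) \<partial>\<mu>)
          + ennreal (1 + eps' \<gamma> \<nu>) * (\<integral>\<^sup>+ t. ennreal (cost t) \<partial>\<mu>)
          + ennreal (\<beta> * (1 + eps' \<gamma> \<nu>)) * (2 * KL \<mu> \<pi> + ennreal (ln (1 / \<eta>))))"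
  proof (intro INF_greatest)
    fix \<nu> \<mu> assume \<nu>: "\<nu> \<in> nu_set \<gamma>" and \<mu>: "\<mu> \<in> space (prob_algebra T)"
    show "ennreal ((norm (f0 - agg (f0 + W \<omega>)))\<^sup>2)
      \<le> ennreal (1 + eps \<gamma> \<nu>) * (\<integral>\<^sup>+ t. ennreal ((norm (f0 - est (f0 + W \<omega>) t))\<^sup>2) \<partial>\<mu>)
          + ennreal (1 + eps' \<gamma> \<nu>) * (\<integral>\<^sup>+ t. ennreal (cost t) \<partial>\<mu>)
          + ennreal (\<beta> * (1 + eps' \<gamma> \<nu>)) * (2 * KL \<mu> \<pi> + ennreal (ln (1 / \<eta>)))"
      unfolding oracle_rhs_eq[OF \<nu>] nn_integral_comparison[OF \<nu> \<mu>, symmetric]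
        scale_back[OF \<nu>, of "(norm (f0 - agg (f0 + W \<omega>)))\<^sup>2", symmetric]
      by (intro mult_left_mono oracle_on_event[OF \<nu> \<mu> \<eta> \<omega>]) simp
  qed
qed

lemma oracle_in_expectation:
  "(\<integral>\<^sup>+ \<omega>. ennreal ((norm (f0 - agg (f0 + W \<omega>)))\<^sup>2) \<partial>P)
    \<le> (INF \<nu>\<in>nu_set \<gamma>. INF \<mu>\<in>space (prob_algebra T).
          ennreal (1 + eps \<gamma> \<nu>) * (\<integral>\<^sup>+ t. (\<integral>\<^sup>+ \<omega>. ennreal ((norm (f0 - est (f0 + W \<omega>) t))\<^sup>2) \<partial>P) \<partial>\<mu>)
        + ennreal (1 + eps' \<gamma> \<nu>) * (\<integral>\<^sup>+ t. ennreal (cost t) \<partial>\<mu>)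
        + ennreal (2 * \<beta> * (1 + eps' \<gamma> \<nu>)) * KL \<mu> \<pi>)"
proof (intro INF_greatest)
  fix \<nu> \<mu> assume \<nu>: "\<nu> \<in> nu_set \<gamma>" and \<mu>: "\<mu> \<in> space (prob_algebra T)"
  note [measurable] = measurable_pac_moment measurable_agg
  have sets_\<mu>[measurable_cong]: "sets \<mu> = sets T" and p\<mu>: "prob_space \<mu>"
    using \<mu> by (auto simp: space_prob_algebra)
  interpret \<mu>: prob_space \<mu> by (rule p\<mu>)
  interpret \<mu>P: pair_sigma_finite \<mu> P by unfold_locales
  define \<alpha> where "\<alpha> = 1 - (1 + \<nu>) * \<gamma>"
  have \<alpha>: "0 < \<alpha>" and \<nu>0: "0 < \<nu>" using \<nu> by (auto simp: \<alpha>_def nu_set_def)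
  let ?D = "\<lambda>\<omega>. (norm (f0 - agg (f0 + W \<omega>)))\<^sup>2"
  let ?I = "\<integral>\<^sup>+ t. (\<integral>\<^sup>+ \<omega>. ennreal ((norm (f0 - est (f0 + W \<omega>) t))\<^sup>2) \<partial>P) \<partial>\<mu>"
  let ?J = "\<integral>\<^sup>+ t. ennreal (cost t) \<partial>\<mu>"
  let ?c = "ennreal (1 + (1 + \<nu>) / \<nu> * \<gamma>)"
  have swap: "(\<integral>\<^sup>+\<omega>. (\<integral>\<^sup>+u. ennreal ((norm (f0 - est (f0 + W \<omega>) u))\<^sup>2) \<partial>\<mu>) \<partial>P) = ?I"
    by (rule \<mu>P.Fubini') measurable
  have "ennreal \<beta> + (\<integral>\<^sup>+\<omega>. ennreal (\<alpha> * ?D \<omega>) \<partial>P) = (\<integral>\<^sup>+\<omega>. ennreal (\<alpha> * ?D \<omega>) + ennreal \<beta> \<partial>P)"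
    by (subst nn_integral_add) (auto simp: emeasure_space_1 add.commute)
  also have "\<dots> \<le> (\<integral>\<^sup>+\<omega>. (?c * (\<integral>\<^sup>+u. ennreal ((norm (f0 - est (f0 + W \<omega>) u))\<^sup>2) \<partial>\<mu>) + ?J)
      + ennreal \<beta> * (2 * KL \<mu> \<pi>) + ennreal \<beta> * pac_moment (f0 + W \<omega>) \<partial>P)"
    unfolding \<alpha>_def nn_integral_comparison[OF \<nu> \<mu>, symmetric]
    by (intro nn_integral_mono oracle_with_moment[OF \<nu> \<mu>])
  also have "\<dots> = ?c * ?I + ?J + ennreal \<beta> * (2 * KL \<mu> \<pi>) + ennreal \<beta> * (\<integral>\<^sup>+\<omega>. pac_moment (f0 + W \<omega>) \<partial>P)"
    unfolding swap[symmetric]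
    by (simp add: nn_integral_add nn_integral_cmult emeasure_space_1)
  also have "\<dots> \<le> ?c * ?I + ?J + ennreal \<beta> * (2 * KL \<mu> \<pi>) + ennreal \<beta> * 1"
    by (intro add_left_mono mult_left_mono expectation_pac_moment) simp
  also have "\<dots> = ennreal \<beta> + (?c * ?I + ?J + ennreal \<beta> * (2 * KL \<mu> \<pi>))" by (simp add: add.commute)
  finally have le: "(\<integral>\<^sup>+\<omega>. ennreal (\<alpha> * ?D \<omega>) \<partial>P) \<le> ?c * ?I + ?J + ennreal \<beta> * (2 * KL \<mu> \<pi>)"
    by (subst (asm) ennreal_add_left_cancel_le) simp
  have "(\<integral>\<^sup>+ \<omega>. ennreal (?D \<omega>) \<partial>P) = (\<integral>\<^sup>+ \<omega>. ennreal (1 / \<alpha>) * ennreal (\<alpha> * ?D \<omega>) \<partial>P)"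
    unfolding \<alpha>_def by (simp only: scale_back[OF \<nu>])
  also have "\<dots> = ennreal (1 / \<alpha>) * (\<integral>\<^sup>+\<omega>. ennreal (\<alpha> * ?D \<omega>) \<partial>P)"
    by (rule nn_integral_cmult) measurable
  also have "\<dots> \<le> ennreal (1 / \<alpha>) * (?c * ?I + ?J + ennreal \<beta> * (2 * KL \<mu> \<pi>))"
    by (intro mult_left_mono le) simp
  also have "\<dots> = ennreal (1 + eps \<gamma> \<nu>) * ?I + ennreal (1 + eps' \<gamma> \<nu>) * ?J
      + ennreal (\<beta> * (1 + eps' \<gamma> \<nu>)) * (2 * KL \<mu> \<pi>)"
    unfolding \<alpha>_def by (rule oracle_rhs_eq[OF \<nu>, symmetric])
  also have "ennreal (\<beta> * (1 + eps' \<gamma> \<nu>)) * (2 * KL \<mu> \<pi>) = ennreal (2 * \<beta> * (1 + eps' \<gamma> \<nu>)) * KL \<mu> \<pi>"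
  proof -
    have "0 \<le> \<beta> * (1 + eps' \<gamma> \<nu>)"
      using \<beta>_pos \<gamma>_ge \<nu>0 \<alpha> by (intro mult_nonneg_nonneg add_nonneg_nonneg) (auto simp: eps'_def \<alpha>_def)
    then have "ennreal (2 * \<beta> * (1 + eps' \<gamma> \<nu>)) = 2 * ennreal (\<beta> * (1 + eps' \<gamma> \<nu>))"
      by (simp add: ennreal_mult mult.assoc)
    then show ?thesis by (simp add: mult_ac)
  qed
  finally show "(\<integral>\<^sup>+ \<omega>. ennreal (?D \<omega>) \<partial>P) \<le> ennreal (1 + eps \<gamma> \<nu>) * ?I + ennreal (1 + eps' \<gamma> \<nu>) * ?J
      + ennreal (2 * \<beta> * (1 + eps' \<gamma> \<nu>)) * KL \<mu> \<pi>" .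
qed

end

theorem theoremA1:
  fixes P :: "'w measure" and W :: "'w \<Rightarrow> real^'n" and Y :: "'w \<Rightarrow> real^'n"
    and f0 b :: "real^'n" and \<sigma> :: real
    and T :: "'t measure" and A :: "'t \<Rightarrow> real^'n^'n" and bt :: "'t \<Rightarrow> real^'n"
    and pen :: "'t \<Rightarrow> real" and \<pi> :: "'t measure"
    and \<beta> V \<delta> \<gamma> C :: real
  assumes "prob_space P"
    and "0 < \<sigma>"
    and "subgaussian_noise P \<sigma> W"
    and "Y = (\<lambda>\<omega>. f0 + W \<omega>)"
    and "A \<in> borel_measurable T" and "bt \<in> borel_measurable T" and "pen \<in> borel_measurable T"
    and "\<And>t. t \<in> space T \<Longrightarrow> sym_psd (A t)"
    and "\<pi> \<in> space (prob_algebra T)"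
    and "0 < \<beta>"
    and "0 < V" and "\<And>t. t \<in> space T \<Longrightarrow> spectral_norm (A t) \<le> V"
    and "0 \<le> \<delta>" and "\<delta> \<le> 1"
    and "\<beta> \<ge> 4 * \<sigma>\<^sup>2 * V * (1 + 4 * \<delta>)" and "\<beta> > 4 * \<sigma>\<^sup>2 * V"
    and "\<gamma> = ewa_gamma \<beta> \<sigma> V \<delta>"
    and "C = tilde_norm T A (f0 - b)"
    and "\<And>t. t \<in> space T \<Longrightarrow>
           pen t \<ge> 4 * \<sigma>\<^sup>2 / (\<beta> - 4 * \<sigma>\<^sup>2 * V) *
             (\<sigma>\<^sup>2 * trace (A t ** A t)
              + 2 * (1 - \<delta>) * (1 + 2 * \<gamma> * V)\<^sup>2
                  * (C\<^sup>2 * trace (A t ** A t) + (norm (bt t))\<^sup>2))"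
  shows "(\<forall>\<eta>. 0 < \<eta> \<and> \<eta> \<le> 1 \<longrightarrow>
            with_prob_at_least P (1 - \<eta>) (\<lambda>\<omega>.
              ennreal ((norm (f0 - f_EWA \<pi> \<beta> \<sigma> A bt b pen (Y \<omega>)))\<^sup>2)
              \<le> (INF \<nu>\<in>nu_set \<gamma>. INF \<mu>\<in>space (prob_algebra T).
                    ennreal (1 + eps \<gamma> \<nu>)
                      * (\<integral>\<^sup>+ t. ennreal ((norm (f0 - fhat A bt b (Y \<omega>) t))\<^sup>2) \<partial>\<mu>)
                  + ennreal (1 + eps' \<gamma> \<nu>)
                      * (\<integral>\<^sup>+ t. ennreal (price \<beta> \<sigma> V \<delta> A bt pen C t) \<partial>\<mu>)
                  + ennreal (\<beta> * (1 + eps' \<gamma> \<nu>)) * (2 * KL \<mu> \<pi> + ennreal (ln (1 / \<eta>))))))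
       \<and> (\<integral>\<^sup>+ \<omega>. ennreal ((norm (f0 - f_EWA \<pi> \<beta> \<sigma> A bt b pen (Y \<omega>)))\<^sup>2) \<partial>P)
          \<le> (INF \<nu>\<in>nu_set \<gamma>. INF \<mu>\<in>space (prob_algebra T).
                ennreal (1 + eps \<gamma> \<nu>)
                  * (\<integral>\<^sup>+ t. (\<integral>\<^sup>+ \<omega>. ennreal ((norm (f0 - fhat A bt b (Y \<omega>) t))\<^sup>2) \<partial>P) \<partial>\<mu>)
              + ennreal (1 + eps' \<gamma> \<nu>)
                  * (\<integral>\<^sup>+ t. ennreal (price \<beta> \<sigma> V \<delta> A bt pen C t) \<partial>\<mu>)
              + ennreal (2 * \<beta> * (1 + eps' \<gamma> \<nu>)) * KL \<mu> \<pi>)"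
proof -
  interpret affine_ewa P W f0 b \<sigma> T A bt pen \<pi> \<beta> V \<delta> \<gamma> C
    unfolding affine_ewa_def affine_ewa_axioms_def using assms by blast
  show ?thesis
    unfolding \<open>Y = (\<lambda>\<omega>. f0 + W \<omega>)\<close>
    using oracle_in_probability oracle_in_expectation by blast
qed

end
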